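(* Let $\Gamma$ be a connected cubic girth-regular graph of girth $4$. Then $\Gamma$ is isomorphic to one of the following: (a) the Möbius ladder $M_n$ for some $n\ge 3$; (b) the prism $Y_n$ for some $n\ge 4$; (c) $\mathrm{Tr}(\Lambda,\leftrightarrow)$ for some tetravalent graph $\Lambda$ (possibly with parallel edges) and some dihedral scheme $\leftrightarrow$ on $\Lambda$.
   Context: $\Gamma$ is a finite simple graph; cubic means $3$-regular. For a graph of finite girth $g$, a girth cycle is a cycle of length $g$, and $\epsilon(e)$ is the number of girth cycles containing the edge $e$. The signature of a vertex $v$ with incident edges $e_1,\ldots,e_k$ ordered so that $\epsilon(e_1)\le\cdots\le\epsilon(e_k)$ is $(\epsilon(e_1),\ldots,\epsilon(e_k))$; a graph is girth-regular if all vertices have the same signature. For $n\ge3$, $M_n=\mathrm{Cay}(\mathbb{Z}_{2n},\{-1,1,n\})$ and $Y_n=C_n\,\square\,K_2$. A graph with parallel edges and loops is $(V,E,\partial)$ with $\partial:E\to\{X\subseteq V:|X|\le2\}$; each edge consists of two mutually inverse arcs with tails; $\mathrm{out}(u)$ is the set of arcs with tail $u$, and tetravalent means $|\mathrm{out}(u)|=4$ for all $u$. A dihedral scheme on $\Lambda$ is an irreflexive symmetric relation $\leftrightarrow$ on the arc set such that (arcs, $\leftrightarrow$) is a $2$-regular simple graph whose components are exactly the sets $\mathrm{out}(u)$. $\mathrm{Tr}(\Lambda,\leftrightarrow)$ is the simple graph on the arcs of $\Lambda$ with $s,t$ adjacent iff $s\leftrightarrow t$ or $s,t$ are mutually inverse.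 *)

theory Defs
  imports
    "HOL-Algebra.Elementary_Groups"
    "HOL-Library.Multiset"
    "HOL-Library.Extended_Nat"
    "Graph_Theory.Graph_Theory"
begin

text \<open>Finite simple graphs are the symmetric loopfree digraphs of \<^locale>\<open>pair_graph\<close>;
  an undirected edge is the set of the two ends of an arc.\<close>

definition edges :: "'a pair_pre_digraph \<Rightarrow> 'a set set" where
  "edges G = (\<lambda>(u, v). {u, v}) ` parcs G"

definition incident_edges :: "'a pair_pre_digraph \<Rightarrow> 'a \<Rightarrow> 'a set set" where
  "incident_edges G v = {e \<in> edges G. v \<in> e}"

definition regular :: "nat \<Rightarrow> 'a pair_pre_digraph \<Rightarrow> bool" where
  "regular k G \<longleftrightarrow> (\<forall>v \<in> pverts G. out_degree G v = k)"

text \<open>A cycle is identified with its set of undirected edges, so that its rotations and its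
  reversal are not counted separately. The bound on the length excludes the closed walks
  \<open>u, v, u\<close>, which are cycles of the symmetric digraph.\<close>

definition cycles :: "'a pair_pre_digraph \<Rightarrow> 'a set set set" where
  "cycles G = {(\<lambda>(u, v). {u, v}) ` set p | p. pre_digraph.cycle G p \<and> length p \<ge> 3}"

definition girth :: "'a pair_pre_digraph \<Rightarrow> enat" where
  "girth G = (INF C \<in> cycles G. enat (card C))"

definition girth_cycles :: "'a pair_pre_digraph \<Rightarrow> 'a set set set" where
  "girth_cycles G = {C \<in> cycles G. enat (card C) = girth G}"

definition eps :: "'a pair_pre_digraph \<Rightarrow> 'a set \<Rightarrow> nat" where
  "eps G e = card {C \<in> girth_cycles G. e \<in> C}"

definition signature :: "'a pair_pre_digraph \<Rightarrow> 'a \<Rightarrow> nat list" where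
  "signature G v = sorted_list_of_multiset (image_mset (eps G) (mset_set (incident_edges G v)))"

definition girth_regular :: "'a pair_pre_digraph \<Rightarrow> bool" where
  "girth_regular G \<longleftrightarrow> (\<forall>u \<in> pverts G. \<forall>v \<in> pverts G. signature G u = signature G v)"

definition cayley_graph :: "('a, 'b) monoid_scheme \<Rightarrow> 'a set \<Rightarrow> 'a pair_pre_digraph" where
  "cayley_graph G S =
    \<lparr>pverts = carrier G, parcs = {(g, g \<otimes>\<^bsub>G\<^esub> s) | g s. g \<in> carrier G \<and> s \<in> S}\<rparr>"

definition moebius_ladder :: "nat \<Rightarrow> int pair_pre_digraph" where
  "moebius_ladder n =
    (let Z = integer_mod_group (2 * n) in cayley_graph Z {inv\<^bsub>Z\<^esub> 1, 1, int n})"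

definition cycle_graph :: "nat \<Rightarrow> nat pair_pre_digraph" where
  "cycle_graph n = \<lparr>pverts = {..<n},
    parcs = {(i, j). i < n \<and> j < n \<and> (j = (i + 1) mod n \<or> i = (j + 1) mod n)}\<rparr>"

definition complete_graph :: "nat \<Rightarrow> nat pair_pre_digraph" where
  "complete_graph n = \<lparr>pverts = {..<n}, parcs = {(i, j). i < n \<and> j < n \<and> i \<noteq> j}\<rparr>"

definition cartesian_product ::
  "'a pair_pre_digraph \<Rightarrow> 'b pair_pre_digraph \<Rightarrow> ('a \<times> 'b) pair_pre_digraph" where
  "cartesian_product G H = \<lparr>pverts = pverts G \<times> pverts H,
    parcs = {((u, x), (v, y)). u \<in> pverts G \<and> v \<in> pverts G \<and> x \<in> pverts H \<and> y \<in> pverts H \<and>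
      ((u, v) \<in> parcs G \<and> x = y \<or> u = v \<and> (x, y) \<in> parcs H)}\<rparr>"

definition prism :: "nat \<Rightarrow> (nat \<times> nat) pair_pre_digraph" where
  "prism n = cartesian_product (cycle_graph n) (complete_graph 2)"

record ('v, 'e) multigraph =
  mverts :: "'v set"
  medges :: "'e set"
  ends :: "'e \<Rightarrow> 'v set"

text \<open>Every edge has one end (a loop) or two; the empty set of ends is excluded since both arcs
  of an edge must have a tail.\<close>

definition multigraph :: "('v, 'e) multigraph \<Rightarrow> bool" where
  "multigraph L \<longleftrightarrow> (\<forall>e \<in> medges L. ends L e \<subseteq> mverts L \<and> card (ends L e) \<in> {1, 2})"

definition loopless :: "('v, 'e) multigraph \<Rightarrow> bool" where
  "loopless L \<longleftrightarrow> (\<forall>e \<in> medges L. card (ends L e) \<noteq> 1)"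

text \<open>An arc is a triple of its edge, its tail and a flag. An edge with ends \<open>u \<noteq> v\<close> has the arcs
  \<open>(e, u, False)\<close> and \<open>(e, v, False)\<close>; the flag serves to give a loop at \<open>u\<close> the two arcs
  \<open>(e, u, False)\<close> and \<open>(e, u, True)\<close>.\<close>

type_synonym ('v, 'e) arc = "'e \<times> 'v \<times> bool"

definition arc_edge :: "('v, 'e) arc \<Rightarrow> 'e" where
  "arc_edge s = fst s"

definition arc_tail :: "('v, 'e) arc \<Rightarrow> 'v" where
  "arc_tail s = fst (snd s)"

definition marcs :: "('v, 'e) multigraph \<Rightarrow> ('v, 'e) arc set" where
  "marcs L = {(e, u, b). e \<in> medges L \<and> u \<in> ends L e \<and> (b \<longrightarrow> card (ends L e) = 1)}"

text \<open>Every edge has exactly two arcs, so two arcs are mutually inverse iff they are the two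
  different arcs of one edge.\<close>

definition mutually_inverse :: "('v, 'e) arc \<Rightarrow> ('v, 'e) arc \<Rightarrow> bool" where
  "mutually_inverse s t \<longleftrightarrow> s \<noteq> t \<and> arc_edge s = arc_edge t"

definition out :: "('v, 'e) multigraph \<Rightarrow> 'v \<Rightarrow> ('v, 'e) arc set" where
  "out L u = {s \<in> marcs L. arc_tail s = u}"

definition tetravalent :: "('v, 'e) multigraph \<Rightarrow> bool" where
  "tetravalent L \<longleftrightarrow> (\<forall>u \<in> mverts L. card (out L u) = 4)"

text \<open>As \<open>R\<close> is symmetric, the strongly connected components are the connected components.\<close>

definition dihedral_scheme :: "('v, 'e) multigraph \<Rightarrow> ('v, 'e) arc rel \<Rightarrow> bool" where
  "dihedral_scheme L R \<longleftrightarrow>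
    R \<subseteq> marcs L \<times> marcs L \<and> irrefl R \<and> sym R \<and>
    (let G = \<lparr>pverts = marcs L, parcs = R\<rparr> in
      regular 2 G \<and> pre_digraph.sccs_verts G = out L ` mverts L)"

definition truncation ::
  "('v, 'e) multigraph \<Rightarrow> ('v, 'e) arc rel \<Rightarrow> ('v, 'e) arc pair_pre_digraph" where
  "truncation L R = \<lparr>pverts = marcs L,
    parcs = {(s, t). s \<in> marcs L \<and> t \<in> marcs L \<and> ((s, t) \<in> R \<or> mutually_inverse s t)}\<rparr>"

end

theory Submission
  imports Defs
begin

text \<open>
  Summing \<open>\<epsilon>\<close> over the edges at \<open>v\<close> counts every 4-cycle through \<open>v\<close> twice, so girth-regularity
  forces every vertex to lie on the same number \<open>k\<close> of 4-cycles. If two vertices have the same neighbourhood, comparing \<open>k\<close> at one of them with \<open>k\<close> at their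
  common neighbours leaves only \<open>K\<^sub>3\<^sub>,\<^sub>3\<close>, which is \<open>M\<^sub>3\<close>. Otherwise each 2-path lies on at most one 4-cycle,
  so that \<open>1 \<le> k \<le> 3\<close>.

  If \<open>k = 3\<close>, the graph closes up to the cube \<open>Y\<^sub>4\<close>.
  If \<open>k = 2\<close>, the edges on two 4-cycles form a perfect matching whose swap \<open>r\<close> is an automorphism;
  the quotient by \<open>r\<close> is a cycle, and the graph is a prism or a Moebius ladder according to
  whether that cycle lifts to a closed walk.
  If \<open>k = 1\<close>, the 4-cycles partition the vertices; contracting them gives \<open>\<Lambda>\<close>, whose edges are the
  edges on no 4-cycle. Such an edge is not a chord of a 4-cycle, as there are no triangles, so \<open>\<Lambda>\<close>
  has no loops.
\<close>

section \<open>Isomorphisms of simple graphs and neighbourhoods of size three\<close>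

lemma digraph_isoI:
  assumes "pair_wf_digraph G"
    and bij: "bij_betw h (pverts G) (pverts H)"
    and sub: "parcs H \<subseteq> pverts H \<times> pverts H"
    and arcs: "\<And>x y. x \<in> pverts G \<Longrightarrow> y \<in> pverts G \<Longrightarrow>
      (h x, h y) \<in> parcs H \<longleftrightarrow> (x, y) \<in> parcs G"
  shows "digraph_iso (with_proj G) (with_proj H)"
proof -
  interpret pair_wf_digraph G by fact
  let ?f = "\<lparr>iso_verts = h, iso_arcs = map_prod h h, iso_head = snd, iso_tail = fst\<rparr>"
  have inj: "inj_on h (pverts G)" and im: "h ` pverts G = pverts H"
    using bij by (auto simp: bij_betw_def)
  have G_sub: "parcs G \<subseteq> pverts G \<times> pverts G"
    by (auto dest: in_arcsD1 in_arcsD2)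
  have "inj_on (map_prod h h) (parcs G)"
    by (rule inj_on_subset[OF map_prod_inj_on[OF inj inj] G_sub])
  then have "pre_digraph.digraph_isomorphism (with_proj G) ?f"
    using inj wf_digraph_axioms by (auto simp: pre_digraph.digraph_isomorphism_def)
  moreover have "map_prod h h ` parcs G = parcs H"
  proof
    show "map_prod h h ` parcs G \<subseteq> parcs H"
      using G_sub arcs by fastforce
    show "parcs H \<subseteq> map_prod h h ` parcs G"
    proof
      fix e assume e: "e \<in> parcs H"
      then obtain x y where "x \<in> pverts G" "y \<in> pverts G" "e = (h x, h y)"
        using sub im by (cases e) (blast elim: imageE)
      with e arcs show "e \<in> map_prod h h ` parcs G" by force
    qed
  qed
  then have "with_proj H = app_iso ?f (with_proj G)"
    using im by (simp add: app_iso_def with_proj_def)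
  ultimately show ?thesis unfolding digraph_iso_def by blast
qed

definition nbhd :: "'a pair_pre_digraph \<Rightarrow> 'a \<Rightarrow> 'a set" where
  "nbhd G v = {w. (v, w) \<in> parcs G}"

lemma out_degree_eq_card_nbhd: "out_degree (with_proj G) v = card (nbhd G v)"
proof -
  have "out_arcs (with_proj G) v = Pair v ` nbhd G v"
    by (auto simp: out_arcs_def nbhd_def)
  then show ?thesis
    by (simp add: out_degree_def card_image inj_on_def)
qed

lemma card_3_obtain_others:
  assumes "card A = 3" "a \<in> A"
  obtains b c where "A = {a, b, c}" "a \<noteq> b" "a \<noteq> c" "b \<noteq> c"
proof -
  have "card (A - {a}) = 2" using assms by simp
  then obtain b c where "A - {a} = {b, c}" "b \<noteq> c" by (auto simp: card_2_iff)
  with assms(2) that[of b c] show thesis by blast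
qed

lemma card_3_eqI:
  assumes "card A = 3" "a \<in> A" "b \<in> A" "c \<in> A" "a \<noteq> b" "a \<noteq> c" "b \<noteq> c"
  shows "A = {a, b, c}"
proof -
  have "finite A" using assms(1) card.infinite by fastforce
  then have "{a, b, c} = A" using assms by (intro card_subset_eq) auto
  then show ?thesis by simp
qed

lemma card_3_obtain_third:
  assumes "card A = 3" "a \<in> A" "b \<in> A" "a \<noteq> b"
  obtains c where "A = {a, b, c}" "c \<noteq> a" "c \<noteq> b"
proof -
  obtain x y where "A = {a, x, y}" "a \<noteq> x" "a \<noteq> y" "x \<noteq> y"
    using card_3_obtain_others[OF assms(1,2)] .
  with assms(3,4) that[of x] that[of y] show thesis by blast
qed

section \<open>Connected cubic graphs\<close>

locale connected_cubic_graph = pair_graph G for G :: "'a pair_pre_digraph" +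
  assumes conn: "Digraph_Component.connected G"
    and cubic: "regular 3 G"
begin

abbreviation "N \<equiv> nbhd G"

lemma N_sym: "u \<in> N v \<longleftrightarrow> v \<in> N u"
  using arcs_symmetric by (auto simp: nbhd_def)

lemma N_subset: "N v \<subseteq> pverts G"
  using in_arcsD2 by (auto simp: nbhd_def)

lemma N_vert: "u \<in> N v \<Longrightarrow> v \<in> pverts G"
  using in_arcsD1 by (auto simp: nbhd_def)

lemma N_irrefl: "v \<notin> N v"
  using no_loops' by (auto simp: nbhd_def)

lemma finite_N [simp]: "finite (N v)"
  using N_subset pair_finite_verts finite_subset by blast

lemma card_N: "v \<in> pverts G \<Longrightarrow> card (N v) = 3"
  using cubic by (simp add: regular_def out_degree_eq_card_nbhd)

text \<open>By symmetry of the arcs, connectedness already means that every vertex is reachable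
  along arcs from a vertex of \<open>S\<close>, and no such walk can leave \<open>S\<close>.\<close>

lemma closed_eq_verts:
  assumes "S \<subseteq> pverts G" "S \<noteq> {}" and closed: "\<And>v. v \<in> S \<Longrightarrow> N v \<subseteq> S"
  shows "S = pverts G"
proof
  obtain s where s: "s \<in> S" using assms by blast
  have sc: "strongly_connected (with_proj G)"
    using symmetric_connected_imp_strongly_connected conn pair_sym_arcs by blast
  show "pverts G \<subseteq> S"
  proof
    fix v assume "v \<in> pverts G"
    then have "s \<rightarrow>\<^sup>*\<^bsub>with_proj G\<^esub> v"
      using sc s assms(1) by (auto simp: strongly_connected_def)
    then have "(s, v) \<in> (parcs G)\<^sup>*"
      using reachable_rtranclI by force
    then show "v \<in> S"
      by (induction rule: rtrancl_induct) (use s closed in \<open>auto simp: nbhd_def\<close>)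
  qed
qed fact

text \<open>The images of the at least three neighbours of \<open>x\<close> are distinct neighbours
  of \<open>h x\<close>, which has only three, so \<open>h\<close> maps neighbourhoods onto
  neighbourhoods. The image of \<open>h\<close> is then closed under adjacency, hence everything. To
  recognise \<open>G\<close> it is thus enough to exhibit an injective homomorphism from the
  model.\<close>

lemma iso_if_embedding:
  fixes H :: "'b pair_pre_digraph"
  assumes H: "pair_wf_digraph H" "finite (pverts H)" "pverts H \<noteq> {}"
    and deg: "\<And>x. x \<in> pverts H \<Longrightarrow> 3 \<le> card (nbhd H x)"
    and inj: "inj_on h (pverts H)"
    and verts: "h ` pverts H \<subseteq> pverts G"
    and arcs: "\<And>x y. (x, y) \<in> parcs H \<Longrightarrow> h y \<in> N (h x)"
  shows "digraph_iso (with_proj G) (with_proj H)"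
proof -
  interpret H: pair_wf_digraph H by fact
  have nbhd_H: "nbhd H x \<subseteq> pverts H" for x
    using H.in_arcsD2 by (auto simp: nbhd_def)
  have N_h: "h ` nbhd H x = N (h x)" if x: "x \<in> pverts H" for x
  proof (rule card_seteq)
    show "h ` nbhd H x \<subseteq> N (h x)" using arcs by (auto simp: nbhd_def)
    have "card (h ` nbhd H x) = card (nbhd H x)"
      by (rule card_image[OF inj_on_subset[OF inj nbhd_H]])
    then show "card (N (h x)) \<le> card (h ` nbhd H x)"
      using deg[OF x] card_N[of "h x"] verts x by auto
  qed simp
  have "h ` pverts H = pverts G"
  proof (rule closed_eq_verts)
    show "N v \<subseteq> h ` pverts H" if "v \<in> h ` pverts H" for v
      using that N_h nbhd_H by blast
  qed (use H verts in auto)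
  then have bij: "bij_betw h (pverts H) (pverts G)" using inj by (simp add: bij_betw_def)
  have "digraph_iso (with_proj H) (with_proj G)"
  proof (rule digraph_isoI[OF H(1) bij])
    show "parcs G \<subseteq> pverts G \<times> pverts G" by (auto dest: in_arcsD1 in_arcsD2)
    fix x y assume xy: "x \<in> pverts H" "y \<in> pverts H"
    have "h y \<in> h ` nbhd H x \<longleftrightarrow> y \<in> nbhd H x"
      using inj_on_image_mem_iff[OF inj xy(2) nbhd_H] .
    with N_h[OF xy(1)] show "(h x, h y) \<in> parcs G \<longleftrightarrow> (x, y) \<in> parcs H"
      by (simp add: nbhd_def)
  qed
  then show ?thesis using digraph_iso_swap H.wf_digraph_axioms by blast
qed

end

section \<open>Recognising Moebius ladders and prisms\<close>

lemma pair_wf_digraph_moebius_ladder: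
  assumes "n \<ge> 1"
  shows "pair_wf_digraph (moebius_ladder n)"
  using assms
  by unfold_locales (auto simp: moebius_ladder_def cayley_graph_def Let_def carrier_integer_mod_group)

lemma pair_wf_digraph_prism: "pair_wf_digraph (prism n)"
  by unfold_locales (auto simp: prism_def cartesian_product_def)

lemma parcs_moebius_ladder:
  assumes "n \<ge> 1"
  shows "parcs (moebius_ladder n) = {(x, (x + s) mod (2 * int n)) | x s.
    x \<in> {0..<2 * int n} \<and> s \<in> {-1 mod (2 * int n), 1, int n}}"
  using assms
  by (auto simp: moebius_ladder_def cayley_graph_def Let_def carrier_integer_mod_group)

lemma pverts_moebius_ladder:
  assumes "n \<ge> 1"
  shows "pverts (moebius_ladder n) = {0..<2 * int n}"
  using assms by (simp add: moebius_ladder_def cayley_graph_def Let_def carrier_integer_mod_group)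

lemma card_nbhd_moebius_ladder:
  assumes "n \<ge> 2" "x \<in> pverts (moebius_ladder n)"
  shows "card (nbhd (moebius_ladder n) x) = 3"
proof -
  let ?m = "2 * int n"
  have x: "0 \<le> x" "x < ?m" using assms by (auto simp: pverts_moebius_ladder)
  have "nbhd (moebius_ladder n) x = (\<lambda>s. (x + s) mod ?m) ` {-1 mod ?m, 1, int n}"
    using assms x unfolding nbhd_def by (subst parcs_moebius_ladder) auto
  then have "nbhd (moebius_ladder n) x = {(x - 1) mod ?m, (x + 1) mod ?m, (x + int n) mod ?m}"
    by (simp add: mod_simps)
  moreover have "(x - 1) mod ?m \<noteq> (x + 1) mod ?m"
    using assms by (auto simp: mod_eq_dvd_iff dest: zdvd_imp_le)
  moreover have "(x - 1) mod ?m \<noteq> (x + int n) mod ?m"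
    using assms by (auto simp: mod_eq_dvd_iff dvd_diff_commute[of _ _ "int n"] dest!: zdvd_imp_le)
  moreover have "(x + 1) mod ?m \<noteq> (x + int n) mod ?m"
    using assms by (auto simp: mod_eq_dvd_iff dvd_diff_commute[of _ 1] dest!: zdvd_imp_le)
  ultimately show ?thesis by simp
qed

lemma card_nbhd_prism:
  assumes "n \<ge> 3" "x \<in> pverts (prism n)"
  shows "card (nbhd (prism n) x) = 3"
proof -
  obtain i j where x: "x = (i, j)" "i < n" "j < 2"
    using assms by (cases x) (auto simp: prism_def cartesian_product_def cycle_graph_def complete_graph_def)
  \<comment> \<open>The cyclic predecessor and successor of \<open>i\<close>, with the wrap-around
    written as a case distinction in place of \<open>mod\<close>. They differ because
    \<open>n \<ge> 3\<close>.\<close>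
  define p where "p = (if i = 0 then n - 1 else i - 1)"
  define s where "s = (if i = n - 1 then 0 else i + 1)"
  have suc: "(k + 1) mod n = (if k = n - 1 then 0 else k + 1)" if "k < n" for k
    using that by auto
  have ps: "p < n" "s < n" using x assms by (auto simp: p_def s_def)
  have adj: "k < n \<and> (k = (i + 1) mod n \<or> i = (k + 1) mod n) \<longleftrightarrow> k = s \<or> k = p" for k
  proof (cases "k < n")
    case True
    show ?thesis unfolding suc[OF True] suc[OF x(2)]
      using True x assms by (auto simp: p_def s_def)
  qed (use ps in auto)
  have "nbhd (prism n) x = {(s, j), (p, j), (i, 1 - j)}"
  proof (rule Set.set_eqI)
    fix z :: "nat \<times> nat"
    obtain k l where z: "z = (k, l)" by (cases z)
    have "z \<in> nbhd (prism n) x \<longleftrightarrow>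
        (k < n \<and> (k = (i + 1) mod n \<or> i = (k + 1) mod n)) \<and> l = j \<or> k = i \<and> l < 2 \<and> l \<noteq> j"
      using x unfolding z
      by (auto simp: nbhd_def prism_def cartesian_product_def cycle_graph_def complete_graph_def)
    also have "\<dots> \<longleftrightarrow> z \<in> {(s, j), (p, j), (i, 1 - j)}"
      unfolding adj z using x by (auto simp: less_2_cases_iff)
    finally show "z \<in> nbhd (prism n) x \<longleftrightarrow> z \<in> {(s, j), (p, j), (i, 1 - j)}" .
  qed
  moreover have "s \<noteq> p" using x assms by (auto simp: p_def s_def)
  moreover have "j \<noteq> 1 - j" by arith
  ultimately show ?thesis by simp
qed

context connected_cubic_graph
begin

text \<open>Here \<open>c\<close> traces the rim of length \<open>2 * n\<close>, and the rungs are
  its antipodal chords. The rim is indexed by naturals whereas the ladder lives on integers, so the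
  embedding is \<open>c \<circ> nat\<close>.\<close>

lemma iso_moebius_ladder:
  assumes n: "n \<ge> 2"
    and inj: "inj_on c {..<2 * n}"
    and step: "\<And>i. i < 2 * n \<Longrightarrow> c ((i + 1) mod (2 * n)) \<in> N (c i)"
    and rung: "\<And>i. i < 2 * n \<Longrightarrow> c ((i + n) mod (2 * n)) \<in> N (c i)"
  shows "digraph_iso (with_proj G) (with_proj (moebius_ladder n))"
proof (rule iso_if_embedding[where h = "c \<circ> nat"])
  let ?M = "moebius_ladder n"
  have V: "pverts ?M = {0..<2 * int n}" using n by (simp add: pverts_moebius_ladder)
  show "pair_wf_digraph ?M" using n by (simp add: pair_wf_digraph_moebius_ladder)
  show "finite (pverts ?M)" "pverts ?M \<noteq> {}" using n by (auto simp: V)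
  show "inj_on (c \<circ> nat) (pverts ?M)"
    using inj_onD[OF inj] by (force simp: V inj_on_def)
  show "3 \<le> card (nbhd ?M x)" if "x \<in> pverts ?M" for x
    using card_nbhd_moebius_ladder[OF n that] by simp
  show "(c \<circ> nat) ` pverts ?M \<subseteq> pverts G"
  proof
    fix v assume "v \<in> (c \<circ> nat) ` pverts ?M"
    then obtain x where "v = c (nat x)" "0 \<le> x" "x < 2 * int n" by (auto simp: V)
    then show "v \<in> pverts G" using N_vert[OF step[of "nat x"]] by simp
  qed
  fix x y assume "(x, y) \<in> parcs ?M"
  then obtain s where x: "0 \<le> x" "x < 2 * int n" and y: "y = (x + s) mod (2 * int n)"
    and s: "s \<in> {-1 mod (2 * int n), 1, int n}"
    using n by (auto simp: parcs_moebius_ladder)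
  have nat_mod: "nat ((z + int k) mod (2 * int n)) = (nat z + k) mod (2 * n)" if "0 \<le> z" for z k
    using that by (simp add: nat_mod_distrib nat_add_distrib nat_mult_distrib)
  have y': "0 \<le> y" "y < 2 * int n" using n by (simp_all add: y)
  consider "s = -1 mod (2 * int n)" | "s = int 1" | "s = int n" using s by auto
  then show "(c \<circ> nat) y \<in> N ((c \<circ> nat) x)"
  proof cases
    case 1
    \<comment> \<open>The arc goes backwards along the rim, so adjacency comes from the forward step
      at \<open>y\<close> and symmetry.\<close>
    then have "(y + int 1) mod (2 * int n) = x"
      using x by (simp add: y mod_simps)
    then show ?thesis using step[of "nat y"] nat_mod[of y 1] y' N_sym by simp
  next
    case 2
    then show ?thesis using step[of "nat x"] nat_mod[of x 1] x by (simp add: y)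
  next
    case 3
    then show ?thesis using rung[of "nat x"] nat_mod[of x n] x by (simp add: y)
  qed
qed

lemma iso_prism:
  assumes n: "n \<ge> 3"
    and inj: "inj_on f {..<n}" "inj_on g {..<n}" "f ` {..<n} \<inter> g ` {..<n} = {}"
    and f: "\<And>i. i < n \<Longrightarrow> f ((i + 1) mod n) \<in> N (f i)"
    and g: "\<And>i. i < n \<Longrightarrow> g ((i + 1) mod n) \<in> N (g i)"
    and rung: "\<And>i. i < n \<Longrightarrow> g i \<in> N (f i)"
  shows "digraph_iso (with_proj G) (with_proj (prism n))"
proof (rule iso_if_embedding)
  let ?h = "\<lambda>(i, j :: nat). if j = 0 then f i else g i"
  have V: "pverts (prism n) = {..<n} \<times> {..<2}"
    by (simp add: prism_def cartesian_product_def cycle_graph_def complete_graph_def)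
  show "pair_wf_digraph (prism n)" by (rule pair_wf_digraph_prism)
  show "finite (pverts (prism n))" "pverts (prism n) \<noteq> {}" using n by (auto simp: V lessThan_empty_iff)
  show "3 \<le> card (nbhd (prism n) x)" if "x \<in> pverts (prism n)" for x
    using card_nbhd_prism[OF n that] by simp
  show "inj_on ?h (pverts (prism n))"
    using inj by (auto simp: V inj_on_def less_2_cases_iff)
  show "?h ` pverts (prism n) \<subseteq> pverts G"
    using N_vert[OF f] N_vert[OF g] by (auto simp: V)
  fix x y assume "(x, y) \<in> parcs (prism n)"
  then show "?h y \<in> N (?h x)"
    using f g rung N_sym
    by (auto simp: prism_def cartesian_product_def cycle_graph_def complete_graph_def less_2_cases_iff)
qed

end

section \<open>Girth cycles as 4-cycles\<close>

lemma pcas_hd_last: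
  assumes "pcas u p v" "p \<noteq> []"
  shows "fst (hd p) = u" "snd (last p) = v"
  using assms by (induction u p v rule: pcas.induct) (auto split: if_splits)

lemma pcas_nth_Suc:
  assumes "pcas u p v" "Suc i < length p"
  shows "fst (p ! Suc i) = snd (p ! i)"
  using assms
proof (induction u p v arbitrary: i rule: pcas.induct)
  case (2 u e es v)
  then show ?case
    by (cases i; cases es) auto
qed simp

lemma pawalk_verts_pcas: "pcas u p v \<Longrightarrow> pawalk_verts u p = u # map snd p"
  by (induction u p v rule: pcas.induct) auto

text \<open>Two different arcs with the same ends would be reverse to each other. As heads do not
  repeat, each would then be the cyclic predecessor of the other, which needs a closed walk of
  length at most 2.\<close>

lemma card_edges_of_cycle:
  assumes cas: "pcas u p u" and dist: "distinct (map snd p)" and len: "3 \<le> length p"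
  shows "card ((\<lambda>(x, y). {x, y}) ` set p) = length p"
proof -
  define pre where "pre i = (if i = 0 then length p - 1 else i - 1)" for i
  have pre: "snd (p ! pre i) = fst (p ! i)" "pre i < length p" if "i < length p" for i
  proof -
    have "p \<noteq> []" using len by auto
    with pcas_hd_last[OF cas] have "snd (p ! (length p - 1)) = fst (p ! 0)"
      by (simp add: hd_conv_nth last_conv_nth)
    with pcas_nth_Suc[OF cas, of "i - 1"] that show "snd (p ! pre i) = fst (p ! i)"
      by (cases i) (auto simp: pre_def)
    show "pre i < length p" using that by (auto simp: pre_def)
  qed
  have nth_inj: "i = j" if "snd (p ! i) = snd (p ! j)" "i < length p" "j < length p" for i j
    using that dist by (simp add: distinct_conv_nth) (metis nth_map length_map)
  have "inj_on (\<lambda>(x, y). {x, y}) (set p)"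
  proof (rule inj_onI, rule ccontr)
    fix e e' assume e: "e \<in> set p" "e' \<in> set p" "(\<lambda>(x, y). {x, y}) e = (\<lambda>(x, y). {x, y}) e'" "e \<noteq> e'"
    obtain i j where ij: "i < length p" "e = p ! i" "j < length p" "e' = p ! j"
      using e by (auto simp: in_set_conv_nth)
    have "fst e = snd e'" "fst e' = snd e"
      using e by (auto simp: doubleton_eq_iff split: prod.splits)
    then have "pre i = j" "pre j = i"
      using ij pre nth_inj by metis+
    then show False using ij(1,3) len by (auto simp: pre_def split: if_splits)
  qed
  then have "card ((\<lambda>(x, y). {x, y}) ` set p) = card (set p)" by (rule card_image)
  also have "\<dots> = length p" using dist by (simp add: distinct_card distinct_map)
  finally show ?thesis .
qed

definition quad :: "'a \<Rightarrow> 'a \<Rightarrow> 'a \<Rightarrow> 'a \<Rightarrow> 'a set set" where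
  "quad a b c d = {{a, b}, {b, c}, {c, d}, {d, a}}"

lemma quad_rotate: "quad a b c d = quad b c d a"
  by (auto simp: quad_def)

lemma quad_flip: "quad a b c d = quad b a d c"
  by (auto simp: quad_def insert_commute)

locale cubic_girth_4 = connected_cubic_graph +
  assumes girth_4: "girth G = 4"
begin

text \<open>Only the two diagonals have to be required distinct; consecutive vertices differ because
  there are no loops.\<close>

definition square :: "'a \<Rightarrow> 'a \<Rightarrow> 'a \<Rightarrow> 'a \<Rightarrow> bool" where
  "square a b c d \<longleftrightarrow> b \<in> N a \<and> c \<in> N b \<and> d \<in> N c \<and> a \<in> N d \<and> a \<noteq> c \<and> b \<noteq> d"

lemma square_rotate: "square a b c d \<Longrightarrow> square b c d a"
  by (auto simp: square_def)

lemma square_flip: "square a b c d \<Longrightarrow> square b a d c"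
  by (auto simp: square_def N_sym)

lemma cycle_iff:
  "pre_digraph.cycle (with_proj G) p \<longleftrightarrow>
    (\<exists>u \<in> pverts G. set p \<subseteq> parcs G \<and> pcas u p u \<and> distinct (map snd p) \<and> p \<noteq> [])"
  by (auto simp: cycle_def awalk_def pawalk_verts_pcas)

lemma cyclesI:
  assumes "u \<in> pverts G" "set p \<subseteq> parcs G" "pcas u p u" "distinct (map snd p)" "3 \<le> length p"
  shows "(\<lambda>(x, y). {x, y}) ` set p \<in> cycles G"
  using assms by (fastforce simp: cycles_def cycle_iff)

lemma triangle_free:
  assumes "b \<in> N a" "c \<in> N b"
  shows "c \<notin> N a"
proof
  assume "c \<in> N a"
  let ?p = "[(a, b), (b, c), (c, a)]"
  have "(\<lambda>(x, y). {x, y}) ` set ?p \<in> cycles G"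
  proof (rule cyclesI)
    have "a \<noteq> b" "b \<noteq> c" "c \<noteq> a" using assms \<open>c \<in> N a\<close> N_irrefl by auto
    then show "a \<in> pverts G" "distinct (map snd ?p)" using N_vert[OF assms(1)] by auto
    show "set ?p \<subseteq> parcs G" using assms \<open>c \<in> N a\<close> N_sym[of c a] by (simp add: nbhd_def)
  qed simp_all
  then have "girth G \<le> enat (card ((\<lambda>(x, y). {x, y}) ` set ?p))"
    unfolding girth_def by (rule INF_lower)
  also have "card ((\<lambda>(x, y). {x, y}) ` set ?p) \<le> 3"
    using card_image_le[of "set ?p" "\<lambda>(x, y). {x, y}"] card_length[of ?p] by simp
  finally show False by (simp add: girth_4 numeral_eq_enat)
qed

lemma card_quad:
  assumes "square a b c d"
  shows "card (quad a b c d) = 4"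
proof -
  have "a \<noteq> b" "b \<noteq> c" "c \<noteq> d" "d \<noteq> a" "a \<noteq> c" "b \<noteq> d"
    using assms N_irrefl by (auto simp: square_def)
  then show ?thesis by (simp add: quad_def doubleton_eq_iff)
qed

lemma girth_cycles_eq: "girth_cycles G = {quad a b c d | a b c d. square a b c d}"
proof (intro equalityI subsetI)
  fix C assume "C \<in> girth_cycles G"
  then obtain p u where C: "C = (\<lambda>(x, y). {x, y}) ` set p" "card C = 4" "3 \<le> length p"
    and p: "set p \<subseteq> parcs G" "pcas u p u" "distinct (map snd p)"
    by (auto simp: girth_cycles_def cycles_def girth_4 cycle_iff numeral_eq_enat)
  \<comment> \<open>The girth bounds the number of edges, and this is also the number of arcs in the
    walk.\<close>
  then have "length p = 4" using card_edges_of_cycle by metis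
  then obtain e1 e2 e3 e4 where "p = [e1, e2, e3, e4]"
    by (auto simp: numeral_eq_Suc length_Suc_conv)
  with p obtain b c d where p': "p = [(u, b), (b, c), (c, d), (d, u)]"
    by (cases e1; cases e2; cases e3; cases e4) auto
  then have "C = quad u b c d" by (simp add: C quad_def)
  moreover have "square u b c d" using p p' by (auto simp: square_def nbhd_def)
  ultimately show "C \<in> {quad a b c d | a b c d. square a b c d}" by blast
next
  fix C assume "C \<in> {quad a b c d | a b c d. square a b c d}"
  then obtain a b c d where C: "C = quad a b c d" and sq: "square a b c d" by blast
  let ?p = "[(a, b), (b, c), (c, d), (d, a)]"
  have "(\<lambda>(x, y). {x, y}) ` set ?p \<in> cycles G"
  proof (rule cyclesI)
    have "b \<in> N a" "a \<noteq> b" "b \<noteq> c" "c \<noteq> d" "d \<noteq> a" "a \<noteq> c" "b \<noteq> d"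
      using sq N_irrefl by (auto simp: square_def)
    then show "a \<in> pverts G" "distinct (map snd ?p)" using N_vert by auto
    show "set ?p \<subseteq> parcs G" using sq by (simp add: square_def nbhd_def)
  qed simp_all
  then have "C \<in> cycles G" by (simp add: C quad_def)
  then show "C \<in> girth_cycles G"
    by (simp add: girth_cycles_def girth_4 C card_quad[OF sq] numeral_eq_enat)
qed

lemma square_exists: "\<exists>a b c d. square a b c d"
proof -
  \<comment> \<open>Over an empty family the infimum would be infinite. Over a nonempty family of
    extended naturals it is a least element, hence attained by some cycle.\<close>
  have "cycles G \<noteq> {}"
    using girth_4 by (auto simp: girth_def Inf_enat_def numeral_eq_enat)
  then obtain x where "x \<in> (\<lambda>C. enat (card C)) ` cycles G" by blast
  then have "girth G \<in> (\<lambda>C. enat (card C)) ` cycles G"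
    unfolding girth_def Inf_enat_def using LeastI[of "\<lambda>x. x \<in> (\<lambda>C. enat (card C)) ` cycles G" x]
    by (simp only: if_not_P if_False split: if_split) blast
  then have "girth_cycles G \<noteq> {}" by (auto simp: girth_cycles_def)
  then show ?thesis by (auto simp: girth_cycles_eq)
qed

section \<open>Counting 4-cycles through edges and vertices\<close>

lemma quad_through_edge:
  assumes sq: "square a b c d" and e: "{v, u} \<in> quad a b c d"
  obtains z y where "square v u z y" "quad a b c d = quad v u z y"
proof -
  have *: "\<exists>z y. square v u z y \<and> quad a b c d = quad v u z y"
    if "square a b c d" "{v, u} = {a, b}" for a b c d
    using that quad_flip[of a b c d] square_flip[of a b c d] by (auto simp: doubleton_eq_iff)
  note r = square_rotate[OF sq] square_rotate[OF square_rotate[OF sq]]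
    square_rotate[OF square_rotate[OF square_rotate[OF sq]]]
  note q = quad_rotate[of a b c d] quad_rotate[of b c d a] quad_rotate[of c d a b]
  from e consider "{v, u} = {a, b}" | "{v, u} = {b, c}" | "{v, u} = {c, d}" | "{v, u} = {d, a}"
    unfolding quad_def by blast
  then have "\<exists>z y. square v u z y \<and> quad a b c d = quad v u z y"
    using *[OF sq] *[OF r(1)] *[OF r(2)] *[OF r(3)] q by cases metis+
  with that show thesis by blast
qed

text \<open>A 4-cycle through \<open>{v, u}\<close> continues from \<open>v\<close> to some
  \<open>y\<close> and from \<open>u\<close> to some \<open>z\<close> adjacent to \<open>y\<close>.
  Its edge set determines both, since it contains just one further edge at \<open>v\<close> and one
  at \<open>u\<close>; so the 4-cycles correspond to the pairs \<open>(y, z)\<close>.\<close>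

lemma eps_eq:
  assumes u: "u \<in> N v"
  shows "eps G {v, u} = (\<Sum>y \<in> N v - {u}. card (N y \<inter> N u - {v}))"
proof -
  let ?S = "SIGMA y : N v - {u}. N y \<inter> N u - {v}"
  let ?q = "\<lambda>(y, z). quad v u z y"
  have "{C \<in> girth_cycles G. {v, u} \<in> C} = ?q ` ?S"
  proof (intro equalityI subsetI)
    fix C assume "C \<in> {C \<in> girth_cycles G. {v, u} \<in> C}"
    then obtain z y where "square v u z y" "C = quad v u z y"
      by (auto simp: girth_cycles_eq elim: quad_through_edge)
    then show "C \<in> ?q ` ?S" using N_sym by (force simp: square_def)
  next
    fix C assume "C \<in> ?q ` ?S"
    then obtain y z where C: "C = quad v u z y" and yz: "y \<in> N v - {u}" "z \<in> N y \<inter> N u - {v}"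
      by auto
    then have "square v u z y" using u N_sym by (auto simp: square_def)
    moreover have "{v, u} \<in> C" by (simp add: C quad_def)
    ultimately show "C \<in> {C \<in> girth_cycles G. {v, u} \<in> C}"
      using C by (auto simp: girth_cycles_eq)
  qed
  moreover have "inj_on ?q ?S"
  proof (rule inj_onI)
    fix s t assume st: "s \<in> ?S" "t \<in> ?S" "?q s = ?q t"
    then obtain y z y' z' where s: "s = (y, z)" and t: "t = (y', z')"
      and eq: "quad v u z y = quad v u z' y'"
      and *: "y \<in> N v" "y \<noteq> u" "z \<in> N u" "z \<noteq> v" "y' \<in> N v" "y' \<noteq> u" "z' \<in> N u" "z' \<noteq> v"
      by auto
    have ne: "v \<noteq> u" "u \<noteq> z" "v \<noteq> y" "u \<noteq> z'" "v \<noteq> y'" using * u N_irrefl by auto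
    have "{y, v} \<in> quad v u z' y'" "{u, z} \<in> quad v u z' y'"
      unfolding eq[symmetric] by (auto simp: quad_def)
    then show "s = t" unfolding s t using * ne by (auto simp: quad_def doubleton_eq_iff)
  qed
  ultimately show ?thesis
    by (simp add: eps_def card_image)
qed

lemma sum_list_signature: "sum_list (signature G v) = (\<Sum>u \<in> N v. eps G {v, u})"
proof -
  have "incident_edges G v = (\<lambda>u. {v, u}) ` N v"
    using N_sym by (auto simp: incident_edges_def edges_def nbhd_def image_iff)
  moreover have "inj_on (\<lambda>u. {v, u}) (N v)"
    by (auto simp: inj_on_def doubleton_eq_iff)
  moreover have "sum_list (signature G v) = sum (eps G) (incident_edges G v)"
    by (simp add: signature_def sum_mset_sum_list[symmetric] sum_unfold_sum_mset)
  ultimately show ?thesis by (simp add: sum.reindex)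
qed

text \<open>The number of 4-cycles through any given 2-path from \<open>a\<close> to \<open>b\<close>.\<close>

definition excess :: "'a \<Rightarrow> 'a \<Rightarrow> nat" where
  "excess a b = card (N a \<inter> N b) - 1"

lemma excess_commute: "excess a b = excess b a"
  by (simp add: excess_def Int_commute)

text \<open>A 4-cycle through \<open>v\<close> uses exactly one pair of neighbours of
  \<open>v\<close>. Hence \<open>eps\<close> of an edge at \<open>v\<close> is the sum of the
  excesses of the two pairs containing its other end, and each pair is counted from both of its
  members.\<close>

lemma sum_list_signature_excess:
  assumes N: "N v = {a, b, c}" and ne: "a \<noteq> b" "a \<noteq> c" "b \<noteq> c"
  shows "sum_list (signature G v) = 2 * (excess a b + excess a c + excess b c)"
proof -
  have v: "v \<in> N a" "v \<in> N b" "v \<in> N c" using N N_sym by auto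
  then have *: "card (N x \<inter> N y - {v}) = excess x y" if "x \<in> {a, b, c}" "y \<in> {a, b, c}" for x y
    using that by (auto simp: excess_def)
  have "N v - {a} = {b, c}" "N v - {b} = {a, c}" "N v - {c} = {a, b}" using N ne by auto
  then have "eps G {v, a} = excess b a + excess c a" "eps G {v, b} = excess a b + excess c b"
    "eps G {v, c} = excess a c + excess b c"
    using eps_eq[of a v] eps_eq[of b v] eps_eq[of c v] * N ne by simp_all
  then show ?thesis
    using ne by (simp add: sum_list_signature N excess_commute)
qed

end

section \<open>Perfect matchings compatible with adjacency: prisms and Moebius ladders\<close>

context cubic_girth_4
begin

lemma verts_nonempty: "pverts G \<noteq> {}"
  using square_exists N_vert by (auto simp: square_def)

text \<open>The edges from \<open>v\<close> to \<open>r v\<close> are the rungs; without them every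
  vertex has two neighbours left, and a walk \<open>f\<close> along them never has a choice. If it
  closes up at \<open>f 0\<close>, then \<open>f\<close> and \<open>r \<circ> f\<close> are the two
  rims of a prism. If it closes up at \<open>r (f 0)\<close>, the two run together into one rim of
  twice the length.\<close>

lemma moebius_ladder_or_prism:
  assumes r_N: "\<And>v. v \<in> pverts G \<Longrightarrow> r v \<in> N v"
    and r_r: "\<And>v. v \<in> pverts G \<Longrightarrow> r (r v) = v"
    and r_hom: "\<And>v w. w \<in> N v \<Longrightarrow> w \<noteq> r v \<Longrightarrow> r w \<in> N (r v)"
  shows "(\<exists>n \<ge> 3. digraph_iso (with_proj G) (with_proj (moebius_ladder n))) \<or>
    (\<exists>n \<ge> 4. digraph_iso (with_proj G) (with_proj (prism n)))"
proof -
  have r_back: "x \<noteq> r y" if "y \<in> N x" "y \<noteq> r x" for x y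
    using that r_r N_vert N_sym by metis
  \<comment> \<open>The walk is built as a sequence of arcs, because avoiding a turn back requires
    remembering the previous vertex.\<close>
  have "\<exists>e. \<forall>n. (snd (e n) \<in> N (fst (e n)) \<and> snd (e n) \<noteq> r (fst (e n))) \<and>
      (fst (e (Suc n)) = snd (e n) \<and> snd (e (Suc n)) \<noteq> fst (e n))"
  proof (rule dependent_nat_choice)
    obtain v where v: "v \<in> pverts G" using verts_nonempty by blast
    then obtain a b where "N v = {r v, a, b}" "r v \<noteq> a"
      using card_3_obtain_others[OF card_N r_N] by metis
    then show "\<exists>e. snd e \<in> N (fst e) \<and> snd e \<noteq> r (fst e)" by (intro exI[of _ "(v, a)"]) auto
  next
    fix e :: "'a \<times> 'a" and n :: nat
    assume e: "snd e \<in> N (fst e) \<and> snd e \<noteq> r (fst e)"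
    obtain x y where xy: "e = (x, y)" by (cases e)
    have y: "y \<in> pverts G" "x \<in> N y" "x \<noteq> r y" using e r_back N_vert N_sym by (auto simp: xy)
    then obtain t where "N y = {x, r y, t}" "t \<noteq> x" "t \<noteq> r y"
      using card_3_obtain_third[OF card_N[OF y(1)] y(2) r_N[OF y(1)] y(3)] by metis
    then show "\<exists>e'. (snd e' \<in> N (fst e') \<and> snd e' \<noteq> r (fst e')) \<and>
        (fst e' = snd e \<and> snd e' \<noteq> fst e)"
      by (intro exI[of _ "(y, t)"]) (auto simp: xy)
  qed
  then obtain e where e: "\<And>n. snd (e n) \<in> N (fst (e n))" "\<And>n. snd (e n) \<noteq> r (fst (e n))"
    "\<And>n. fst (e (Suc n)) = snd (e n)" "\<And>n. snd (e (Suc n)) \<noteq> fst (e n)"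
    by blast
  define f where "f n = fst (e n)" for n
  have f_Suc: "f (Suc n) \<in> N (f n)" "f (Suc n) \<noteq> r (f n)" "f (Suc (Suc n)) \<noteq> f n" for n
    using e by (auto simp: f_def)
  have f_V: "f n \<in> pverts G" for n using f_Suc(1) N_vert by blast
  have N_f: "N (f (Suc n)) = {f n, f (Suc (Suc n)), r (f (Suc n))}" for n
  proof (rule card_3_eqI)
    show "f n \<noteq> r (f (Suc n))" using f_Suc r_back by blast
  qed (use f_Suc f_V card_N r_N N_sym in \<open>auto dest: sym\<close>)
  \<comment> \<open>Modulo \<open>r\<close>, the walk \<open>f\<close> runs along a simple 2-regular graph (a double edge would give a
    triangle), so its first repetition closes up at \<open>f 0\<close>.\<close>
  define eqv where "eqv x y \<longleftrightarrow> x = y \<or> x = r y" for x y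
  have eqv_sym: "eqv x y" if "eqv y x" "x \<in> pverts G" for x y
    using that r_r by (auto simp: eqv_def)
  have step1: "\<not> eqv (f (Suc n)) (f n)" for n
    using f_Suc[of n] N_irrefl by (metis eqv_def)
  have step2: "\<not> eqv (f (Suc (Suc n))) (f n)" for n
    using f_Suc[of n] f_Suc(1)[of "Suc n"] triangle_free r_N[OF f_V[of n]] by (metis eqv_def)
  \<comment> \<open>Adjacency descends to the quotient by \<open>r\<close>: a vertex adjacent to
    either representative of the class of \<open>f (Suc i)\<close> lies in that class or in that of
    its predecessor or successor on the walk. For the representative \<open>r (f (Suc i))\<close>
    this is obtained by applying \<open>r_hom\<close>.\<close>
  have adj: "eqv y (f i) \<or> eqv y (f (Suc i)) \<or> eqv y (f (Suc (Suc i)))"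
    if y: "y \<in> N x" and x: "eqv x (f (Suc i))" for x y i
  proof (cases "x = f (Suc i)")
    case True
    with y show ?thesis by (auto simp: N_f eqv_def)
  next
    case False
    with x have x: "x = r (f (Suc i))" by (auto simp: eqv_def)
    have rx: "r x = f (Suc i)" using r_r f_V by (simp add: x)
    show ?thesis
    proof (cases "y = r x")
      case True
      with rx show ?thesis by (simp add: eqv_def)
    next
      case False
      with r_hom[OF y] rx have "r y \<in> N (f (Suc i))" by simp
      moreover have "r (r y) = y" using r_r y N_subset by blast
      ultimately show ?thesis
        using r_r[OF f_V] unfolding N_f eqv_def by auto
    qed
  qed
  have "\<exists>n. \<exists>i<n. eqv (f n) (f i)"
  proof -
    have "range f \<subseteq> pverts G" using f_V by blast
    then have "\<not> inj f" using pair_finite_verts finite_subset finite_imageD infinite_UNIV_nat by blast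
    then obtain i j where "f i = f j" "i < j" by (metis injI linorder_neqE_nat)
    then show ?thesis unfolding eqv_def by metis
  qed
  then obtain n where "\<exists>i<n. eqv (f n) (f i)" and least: "\<And>m. m < n \<Longrightarrow> \<not> (\<exists>i<m. eqv (f m) (f i))"
    using exists_least_iff[of "\<lambda>n. \<exists>i<n. eqv (f n) (f i)"] by blast
  then obtain i where i: "i < n" "eqv (f n) (f i)" by blast
  have least': "i = j" if "eqv (f i) (f j)" "i < n" "j < n" for i j
    using least that eqv_sym f_V by (metis linorder_neqE_nat)
  \<comment> \<open>If the first repetition were at \<open>i > 0\<close>, the class of the
    predecessor of \<open>f n\<close> would be that of \<open>f i\<close> or of one of its two
    neighbours on the walk. Each option gives an earlier repetition or contradicts
    \<open>step1\<close> or \<open>step2\<close>.\<close>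
  have n0: "eqv (f n) (f 0)"
  proof (cases i)
    case (Suc i')
    obtain n' where n': "n = Suc n'" using i by (cases n) auto
    have "f n' \<in> N (f n)" using f_Suc(1) N_sym n' by blast
    from adj[OF this] i(2) Suc
    consider "eqv (f n') (f i')" | "eqv (f n') (f i)" | "eqv (f n') (f (Suc i))" by blast
    then have False
    proof cases
      case 1
      then show False using least'[of n' i'] n' i(1) Suc by simp
    next
      case 2
      then have "n' = i" using least'[of n' i] n' i(1) by simp
      then show False using step1 i(2) n' by blast
    next
      case 3
      show False
      proof (cases "Suc i < n")
        case True
        then have "n' = Suc i" using least'[of n' "Suc i"] 3 n' by simp
        then show False using step2 i(2) n' by blast
      next
        case False
        then have "n = Suc i" using i(1) by simp
        then show False using step1 i(2) by blast
      qed
    qed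
    then show ?thesis ..
  qed (use i in simp)
  have n3: "n \<ge> 3"
  proof (rule ccontr)
    assume "\<not> n \<ge> 3"
    then have "n = Suc 0 \<or> n = Suc (Suc 0)" using i(1) by auto
    then show False using n0 step1 step2 by blast
  qed
  have r_inj: "x = y" if "r x = r y" "x \<in> pverts G" "y \<in> pverts G" for x y
    using that r_r by metis
  have rf_Suc: "r (f (Suc n)) \<in> N (r (f n))" for n using r_hom f_Suc by blast
  \<comment> \<open>Minimality of \<open>n\<close> reduces this to \<open>i = j\<close>, where it
    says that \<open>r\<close> has no fixed point.\<close>
  have f_ne_rf: "f i \<noteq> r (f j)" if "i < n" "j < n" for i j
    using least'[of i j] that r_N[OF f_V[of j]] N_irrefl by (metis eqv_def)
  have f_inj: "i = j" if "f i = f j" "i < n" "j < n" for i j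
    using least' that by (simp add: eqv_def)
  show ?thesis
  proof (cases "f n = f 0")
    case True
    \<comment> \<open>A rim of length 3 would be a triangle, so the prism has
      \<open>n \<ge> 4\<close>.\<close>
    have "n \<noteq> 3"
    proof
      assume "n = 3"
      then have "f 3 \<in> N (f 2)" "f 2 \<in> N (f 1)" "f 1 \<in> N (f 3)"
        using f_Suc(1)[of 2] f_Suc(1)[of 1] f_Suc(1)[of 0] True by (simp_all add: numeral_eq_Suc)
      then show False using triangle_free N_sym by blast
    qed
    with n3 have "n \<ge> 4" by simp
    moreover have "digraph_iso (with_proj G) (with_proj (prism n))"
    proof (rule iso_prism[OF n3, of f "\<lambda>i. r (f i)"])
      show "inj_on f {..<n}" using f_inj by (auto simp: inj_on_def)
      show "inj_on (\<lambda>i. r (f i)) {..<n}" using f_inj r_inj f_V by (auto simp: inj_on_def)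
      show "f ` {..<n} \<inter> (\<lambda>i. r (f i)) ` {..<n} = {}" using f_ne_rf by auto
      fix i assume "i < n"
      then have "f ((i + 1) mod n) = f (Suc i)" using True by (cases "Suc i = n") auto
      then show "f ((i + 1) mod n) \<in> N (f i)" "r (f ((i + 1) mod n)) \<in> N (r (f i))"
        using f_Suc rf_Suc by simp_all
      show "r (f i) \<in> N (f i)" using r_N f_V by blast
    qed
    ultimately show ?thesis by blast
  next
    case False
    with n0 have fn: "f n = r (f 0)" by (simp add: eqv_def)
    then have rfn: "r (f n) = f 0" using r_r f_V by simp
    \<comment> \<open>The rim runs through \<open>f 0\<close>, ..., \<open>f (n - 1)\<close> and
      then through their images under \<open>r\<close>. The two joins are
      \<open>f n = r (f 0)\<close> and \<open>r (f n) = f 0\<close>, and a shift by \<open>n\<close>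
      is exactly \<open>r\<close>.\<close>
    define c where "c i = (if i < n then f i else r (f (i - n)))" for i
    have "digraph_iso (with_proj G) (with_proj (moebius_ladder n))"
    proof (rule iso_moebius_ladder)
      show "n \<ge> 2" using n3 by simp
      show "inj_on c {..<2 * n}"
      proof (rule inj_onI)
        fix i j assume ij: "i \<in> {..<2 * n}" "j \<in> {..<2 * n}" and eq: "c i = c j"
        then have less: "i < n \<or> i - n < n" "j < n \<or> j - n < n" by auto
        show "i = j"
        proof (cases "i < n"; cases "j < n")
          assume "i < n" "j < n"
          then show ?thesis using eq f_inj by (simp add: c_def)
        next
          assume "i < n" "\<not> j < n"
          then show ?thesis using eq less f_ne_rf by (auto simp: c_def)
        next
          assume "\<not> i < n" "j < n"
          then show ?thesis using eq less f_ne_rf by (auto simp: c_def dest: sym)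
        next
          assume "\<not> i < n" "\<not> j < n"
          moreover from this have "f (i - n) = f (j - n)" using eq r_inj f_V by (simp add: c_def)
          ultimately show ?thesis using less f_inj by fastforce
        qed
      qed
      fix i assume i: "i < 2 * n"
      consider "Suc i < n" | "Suc i = n" | "n \<le> i" "Suc i < 2 * n" | "n \<le> i" "Suc i = 2 * n"
        using i by linarith
      then show "c ((i + 1) mod (2 * n)) \<in> N (c i)"
      proof cases
        case 1
        then show ?thesis using f_Suc by (simp add: c_def)
      next
        case 2
        then show ?thesis using f_Suc(1)[of i] fn by (auto simp: c_def)
      next
        case 3
        then show ?thesis using rf_Suc[of "i - n"] by (simp add: c_def Suc_diff_le)
      next
        case 4
        then have "Suc (i - n) = n" by linarith
        then show ?thesis using 4 rf_Suc[of "i - n"] rfn n3 by (simp add: c_def)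
      qed
      show "c ((i + n) mod (2 * n)) \<in> N (c i)"
      proof (cases "i < n")
        case True
        then show ?thesis using r_N f_V by (simp add: c_def)
      next
        case False
        then have "(i + n) mod (2 * n) = i - n" using i by (simp add: mod_if)
        then show ?thesis using False i r_N f_V N_sym by (auto simp: c_def)
      qed
    qed
    with n3 show ?thesis by blast
  qed
qed

section \<open>The cube\<close>

lemma iso_cube:
  assumes twin_free: "\<And>v w. v \<in> pverts G \<Longrightarrow> w \<in> pverts G \<Longrightarrow> N v = N w \<Longrightarrow> v = w"
    and corners: "\<And>v a b. a \<in> N v \<Longrightarrow> b \<in> N v \<Longrightarrow> a \<noteq> b \<Longrightarrow> \<exists>z. z \<noteq> v \<and> z \<in> N a \<and> z \<in> N b"
  shows "digraph_iso (with_proj G) (with_proj (prism 4))"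
proof -
  obtain v where v: "v \<in> pverts G" using verts_nonempty by blast
  then obtain a where "a \<in> N v" using card_N by (metis card.empty ex_in_conv zero_neq_numeral)
  then obtain b c where Nv: "N v = {a, b, c}" and abc: "a \<noteq> b" "a \<noteq> c" "b \<noteq> c"
    using card_3_obtain_others card_N v by metis
  \<comment> \<open>The vertices \<open>p\<close>, \<open>q\<close> and \<open>s\<close> complete
    the three pairs of neighbours of \<open>v\<close> to squares. A vertex other than
    \<open>v\<close> adjacent to all of \<open>a\<close>, \<open>b\<close>, \<open>c\<close> would
    be a twin of \<open>v\<close>, which makes \<open>p\<close>, \<open>q\<close>, \<open>s\<close>
    distinct.\<close>
  obtain p where p: "p \<noteq> v" "p \<in> N a" "p \<in> N b" using corners[of a v b] Nv abc by auto
  obtain q where q: "q \<noteq> v" "q \<in> N a" "q \<in> N c" using corners[of a v c] Nv abc by auto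
  obtain s where s: "s \<noteq> v" "s \<in> N b" "s \<in> N c" using corners[of b v c] Nv abc by auto
  have not_all: "x \<notin> N a \<or> x \<notin> N b \<or> x \<notin> N c" if "x \<noteq> v" for x
  proof (rule ccontr)
    assume "\<not> ?thesis"
    then have x: "a \<in> N x" "b \<in> N x" "c \<in> N x" using N_sym by auto
    then have "x \<in> pverts G" using N_vert by blast
    moreover from this have "N x = {a, b, c}" using x abc card_N by (intro card_3_eqI) auto
    ultimately show False using twin_free v Nv that by metis
  qed
  have pqs: "p \<noteq> q" "p \<noteq> s" "q \<noteq> s" using not_all p q s by auto
  have not_Nv: "x \<notin> {a, b, c}" if "x \<in> N a \<or> x \<in> N b \<or> x \<in> N c" for x
    using that Nv triangle_free by blast
  have v_in: "v \<in> N a" "v \<in> N b" "v \<in> N c" using Nv N_sym by auto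
  have verts: "a \<in> pverts G" "b \<in> pverts G" "p \<in> pverts G" using Nv N_subset p by blast+
  have Na: "N a = {v, p, q}" and Nb: "N b = {v, p, s}"
    using card_3_eqI[OF card_N[OF verts(1)], of v p q] card_3_eqI[OF card_N[OF verts(2)], of v p s]
      v_in p q s pqs by auto
  obtain z where Np: "N p = {a, b, z}" and z: "z \<noteq> a" "z \<noteq> b"
    using card_3_obtain_third[OF card_N[OF verts(3)], of a b] p abc N_sym by metis
  have "c \<notin> N p" using not_all[of p] p N_sym by blast
  then have zc: "z \<noteq> c" using Np by auto
  then have "z \<notin> N v" using z Nv by auto
  then have zv: "v \<notin> N z" using N_sym by blast
  \<comment> \<open>The 2-path from \<open>a\<close> through \<open>p\<close> to \<open>z\<close>
    closes up at a neighbour of \<open>a\<close> other than \<open>p\<close>. It is not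
    \<open>v\<close>, which is not adjacent to \<open>z\<close>, so it is \<open>q\<close>; likewise
    \<open>s\<close> at \<open>b\<close>.\<close>
  have qz: "q \<in> N z" using corners[of a p z] Np z Na zv by auto
  have sz: "s \<in> N z" using corners[of b p z] Np z Nb zv by auto
  have "p \<notin> N v" "v \<notin> N v" "z \<noteq> p" "z \<noteq> q" "z \<noteq> s"
    using not_Nv[of p] p Nv N_irrefl Np qz sz by auto
  then have zne: "z \<noteq> v" "z \<noteq> p" "z \<noteq> q" "z \<noteq> s" "v \<notin> {a, b, c}"
    using Np N_sym Nv by blast+
  have adj: "a \<in> N v" "c \<in> N v" "p \<in> N a" "b \<in> N p" "v \<in> N b" "q \<in> N c" "z \<in> N q" "s \<in> N z" "c \<in> N s"
    "q \<in> N a" "z \<in> N p" "s \<in> N b"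
    using Nv p q s Np qz sz v_in N_sym by auto
  have dist: "distinct [v, a, p, b]" "distinct [c, q, z, s]"
    "set [v, a, p, b] \<inter> set [c, q, z, s] = {}"
    using abc p q s pqs z zc zne not_Nv[of p] not_Nv[of q] not_Nv[of s] by auto
  have less4: "i < 4 \<longleftrightarrow> i = 0 \<or> i = 1 \<or> i = 2 \<or> i = 3" for i :: nat by auto
  show ?thesis
  \<comment> \<open>Two opposite faces of the cube, listed so that equal positions are joined by an
    edge.\<close>
  proof (rule iso_prism[of 4 "(!) [v, a, p, b]" "(!) [c, q, z, s]"])
    show "inj_on ((!) [v, a, p, b]) {..<4}" "inj_on ((!) [c, q, z, s]) {..<4}"
      using dist by (auto intro!: inj_on_nth)
    show "(!) [v, a, p, b] ` {..<4} \<inter> (!) [c, q, z, s] ` {..<4} = {}"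
      using dist(3) by (auto simp: less4)
  qed (use adj in \<open>auto simp: less4\<close>)
qed

end

section \<open>Vertices partitioned by 4-cycles: truncations\<close>

lemma (in wf_digraph) sccs_verts_symmetric:
  assumes "symmetric G"
  shows "sccs_verts = (\<lambda>v. {w. v \<rightarrow>\<^sup>* w}) ` verts G"
proof (intro equalityI subsetI)
  fix S assume S: "S \<in> sccs_verts"
  then obtain v where v: "v \<in> S" unfolding sccs_verts_def by blast
  then have "S = {w. v \<rightarrow>\<^sup>* w}"
    using S symmetric_reachable[OF assms] unfolding sccs_verts_def by blast
  moreover have "v \<in> verts G" using S v reachable_in_verts(1) unfolding sccs_verts_def by blast
  ultimately show "S \<in> (\<lambda>v. {w. v \<rightarrow>\<^sup>* w}) ` verts G" by blast
next
  fix S assume "S \<in> (\<lambda>v. {w. v \<rightarrow>\<^sup>* w}) ` verts G"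
  then obtain v where v: "v \<in> verts G" "S = {w. v \<rightarrow>\<^sup>* w}" by blast
  then show "S \<in> sccs_verts"
    using symmetric_reachable[OF assms] reachable_trans unfolding sccs_verts_def by blast
qed

context cubic_girth_4
begin

text \<open>By the hypothesis on corners, \<open>m v\<close> is the neighbour of \<open>v\<close>
  across the one edge at \<open>v\<close> on no 4-cycle, and the other two neighbours of
  \<open>v\<close> span a 4-cycle with it. The edges from \<open>v\<close> to \<open>m v\<close>
  become the edges of the multigraph and the 4-cycles become its vertices, so each \<open>v\<close>
  turns into the arc along its matching edge that starts at its 4-cycle.\<close>

lemma iso_truncation:
  assumes m_N: "\<And>v. v \<in> pverts G \<Longrightarrow> m v \<in> N v"
    and corner: "\<And>v a b. a \<in> N v \<Longrightarrow> b \<in> N v \<Longrightarrow> a \<noteq> b \<Longrightarrow>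
      (\<exists>z. z \<noteq> v \<and> z \<in> N a \<and> z \<in> N b) \<longleftrightarrow> a \<noteq> m v \<and> b \<noteq> m v"
  shows "\<exists>(L :: (nat, nat) multigraph) R. multigraph L \<and> loopless L \<and> tetravalent L \<and>
    dihedral_scheme L R \<and> digraph_iso (with_proj G) (with_proj (truncation L R))"
proof -
  let ?V = "pverts G"
  have m_V: "m v \<in> ?V" if "v \<in> ?V" for v using m_N[OF that] N_subset by blast
  have m_ne: "m v \<noteq> v" if "v \<in> ?V" for v using m_N[OF that] N_irrefl by metis
  \<comment> \<open>Otherwise the 2-path from \<open>v\<close> through \<open>m v\<close> to
    \<open>y\<close> closes up to a 4-cycle containing the edge from \<open>v\<close> to
    \<open>m v\<close>, against \<open>corner\<close> at \<open>v\<close>.\<close>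
  have m_m: "m (m v) = v" if v: "v \<in> ?V" for v
  proof (rule ccontr)
    assume ne: "m (m v) \<noteq> v"
    have "v \<in> N (m v)" using m_N[OF v] N_sym by blast
    then obtain y where y: "N (m v) = {v, m (m v), y}" "y \<noteq> v" "y \<noteq> m (m v)"
      using card_3_obtain_third[OF card_N[OF m_V[OF v]] _ m_N[OF m_V[OF v]]] ne by metis
    then obtain t where t: "t \<noteq> m v" "t \<in> N v" "t \<in> N y"
      using corner[of v "m v" y] ne by auto
    then have "y \<in> N t" "y \<in> N (m v)" using N_sym y by auto
    then show False using corner[of t v "m v"] t m_N[OF v] y by blast
  qed

  define S where "S = {(v, w). w \<in> N v \<and> w \<noteq> m v}"
  have sym_S: "sym S"
  proof (rule symI)
    fix v w assume "(v, w) \<in> S"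
    then have w: "w \<in> N v" "w \<noteq> m v" by (auto simp: S_def)
    moreover have "w \<in> ?V" using w N_subset by blast
    ultimately have "v \<noteq> m w" using m_m by metis
    then show "(w, v) \<in> S" using w N_sym[of w v] by (simp add: S_def)
  qed
  have S_V: "v \<in> ?V" "w \<in> ?V" if "(v, w) \<in> S" for v w
    using that N_vert N_subset by (auto simp: S_def)
  define B where "B v = S\<^sup>* `` {v}" for v
  have B_self: "v \<in> B v" for v by (simp add: B_def)
  have B_eq: "B v = B w" if "w \<in> B v" for v w
    using that sym_rtrancl[OF sym_S] by (auto simp: B_def dest: symD intro: rtrancl_trans)
  have B_V: "B v \<subseteq> ?V" if "v \<in> ?V" for v
  proof
    fix w assume "w \<in> B v"
    then have "(v, w) \<in> S\<^sup>*" by (simp add: B_def)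
    then show "w \<in> ?V" using that S_V by (cases rule: rtranclE) auto
  qed
  \<comment> \<open>The 4-cycle on \<open>v\<close>, \<open>a\<close>, \<open>z\<close>,
    \<open>b\<close> is a whole class of \<open>S\<close>: at each of its vertices the third
    neighbour is the one given by \<open>m\<close>. The vertex \<open>m v\<close> is outside, since
    \<open>m v = z\<close> would create a triangle with \<open>a\<close>.\<close>
  have block: "card (B v) = 4 \<and> m v \<notin> B v" if v: "v \<in> ?V" for v
  proof -
    obtain a b where Nv: "N v = {m v, a, b}" and ab: "m v \<noteq> a" "m v \<noteq> b" "a \<noteq> b"
      using card_3_obtain_others[OF card_N[OF v] m_N[OF v]] .
    then obtain z where z: "z \<noteq> v" "z \<in> N a" "z \<in> N b" using corner[of a v b] by auto
    have V: "a \<in> ?V" "b \<in> ?V" "z \<in> ?V" using Nv z N_subset by blast+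
    have adj: "v \<in> N a" "v \<in> N b" "a \<in> N z" "b \<in> N z" "a \<in> N v" "b \<in> N v" using Nv z N_sym by auto
    have "v \<noteq> m a \<and> z \<noteq> m a" using corner[of v a z] adj z ab by auto
    then have Na: "N a = {v, z, m a}" using adj z V card_N m_N by (intro card_3_eqI) auto
    have "v \<noteq> m b \<and> z \<noteq> m b" using corner[of v b z] adj z ab by auto
    then have Nb: "N b = {v, z, m b}" using adj z V card_N m_N by (intro card_3_eqI) auto
    have mz: "a \<noteq> m z \<and> b \<noteq> m z" using corner[of a z b] adj z ab by auto
    then have Nz: "N z = {a, b, m z}" using adj z V card_N m_N ab by (intro card_3_eqI) auto
    have "B v = {v, a, b, z}"
    proof
      show "B v \<subseteq> {v, a, b, z}"
      proof
        fix w assume "w \<in> B v"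
        then have "(v, w) \<in> S\<^sup>*" by (simp add: B_def)
        then show "w \<in> {v, a, b, z}"
          by (induction rule: rtrancl_induct) (use Nv Na Nb Nz in \<open>auto simp: S_def\<close>)
      qed
      have "(v, a) \<in> S" "(v, b) \<in> S" "(z, a) \<in> S" using adj ab mz by (auto simp: S_def)
      moreover from this have "(a, z) \<in> S" using sym_S by (auto dest: symD)
      ultimately have "(v, a) \<in> S\<^sup>*" "(v, b) \<in> S\<^sup>*" "(v, z) \<in> S\<^sup>*" by auto
      then show "{v, a, b, z} \<subseteq> B v" by (auto simp: B_def)
    qed
    moreover have "v \<notin> {a, b, m v}" "z \<notin> {a, b}" using adj N_irrefl[of v] N_irrefl[of z] Nv by auto
    moreover have "m v \<noteq> z" using triangle_free[OF adj(5) z(2)] m_N[OF v] by auto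
    ultimately show ?thesis using ab z by auto
  qed

  \<comment> \<open>An injective coding of vertex sets by naturals. It allows matching edges and
    4-cycles to be used as the edges and vertices of a multigraph over \<open>nat\<close>.\<close>
  obtain \<kappa> :: "'a set \<Rightarrow> nat" where \<kappa>: "inj_on \<kappa> (Pow ?V)"
    using finite_imp_inj_to_nat_seg[of "Pow ?V"] pair_finite_verts by auto
  define e where "e v = \<kappa> {v, m v}" for v
  define t where "t v = \<kappa> (B v)" for v
  \<comment> \<open>The inverse of the arc \<open>\<phi> v\<close> is \<open>\<phi> (m v)\<close>.
    The flag is always \<open>False\<close>, as \<open>t_m\<close> excludes loops.\<close>
  define \<phi> where "\<phi> v = (e v, t v, False)" for v
  have e_eq: "e v = e w \<longleftrightarrow> w = v \<or> w = m v" if "v \<in> ?V" "w \<in> ?V" for v w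
  proof -
    have "e v = e w \<longleftrightarrow> {v, m v} = {w, m w}"
      unfolding e_def using that m_V by (intro inj_on_eq_iff[OF \<kappa>]) auto
    then show ?thesis using that m_m by (auto simp: doubleton_eq_iff)
  qed
  have t_eq: "t v = t w \<longleftrightarrow> w \<in> B v" if "v \<in> ?V" "w \<in> ?V" for v w
  proof -
    have "t v = t w \<longleftrightarrow> B v = B w"
      unfolding t_def using that B_V by (intro inj_on_eq_iff[OF \<kappa>]) auto
    then show ?thesis using B_eq B_self by blast
  qed
  have e_m: "e (m v) = e v" if "v \<in> ?V" for v using e_eq[OF that m_V[OF that]] by simp
  have t_m: "t v \<noteq> t (m v)" if "v \<in> ?V" for v using t_eq[OF that m_V[OF that]] block[OF that] by simp
  have inj: "inj_on \<phi> ?V"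
  proof (rule inj_onI)
    fix v w assume "v \<in> ?V" "w \<in> ?V" "\<phi> v = \<phi> w"
    then show "v = w" using e_eq[of v w] t_m[of v] by (auto simp: \<phi>_def)
  qed

  define L :: "(nat, nat) multigraph"
    where "L = \<lparr>mverts = t ` ?V, medges = e ` ?V, ends = \<lambda>x. t ` {v \<in> ?V. e v = x}\<rparr>"
  have ends: "ends L (e v) = {t v, t (m v)}" if v: "v \<in> ?V" for v
  proof -
    have "{w \<in> ?V. e w = e v} = {v, m v}" using e_eq[OF _ v] m_V[OF v] m_m v by auto
    then show ?thesis by (simp add: L_def)
  qed
  have card_ends: "card (ends L x) = 2" if x: "x \<in> medges L" for x
  proof -
    obtain v where "v \<in> ?V" "x = e v" using x by (auto simp: L_def)
    then show ?thesis using ends t_m by simp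
  qed
  have marcs: "marcs L = \<phi> ` ?V"
  proof (intro equalityI subsetI)
    fix x assume "x \<in> marcs L"
    then obtain y u b where x: "x = (y, u, b)" "y \<in> medges L" "u \<in> ends L y"
      and "b \<longrightarrow> card (ends L y) = 1"
      unfolding marcs_def by blast
    with card_ends[of y] have "\<not> b" by auto
    from x obtain v where v: "v \<in> ?V" "y = e v" by (auto simp: L_def)
    with x ends have "u = t v \<or> u = t (m v)" by auto
    with x v \<open>\<not> b\<close> e_m have "x = \<phi> v \<or> x = \<phi> (m v)" by (auto simp: \<phi>_def)
    then show "x \<in> \<phi> ` ?V" using v m_V by auto
  next
    fix x assume "x \<in> \<phi> ` ?V"
    then obtain v where v: "v \<in> ?V" "x = \<phi> v" by auto
    then show "x \<in> marcs L" using ends by (auto simp: marcs_def \<phi>_def L_def)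
  qed
  have out: "out L (t v) = \<phi> ` B v" if v: "v \<in> ?V" for v
  proof -
    have "out L (t v) = \<phi> ` {w \<in> ?V. t w = t v}" unfolding out_def marcs by (auto simp: arc_tail_def \<phi>_def)
    also have "{w \<in> ?V. t w = t v} = B v" using t_eq[OF v] B_V[OF v] by (auto simp: eq_commute)
    finally show ?thesis .
  qed

  define R where "R = map_prod \<phi> \<phi> ` S"
  have R_iff: "(\<phi> v, \<phi> w) \<in> R \<longleftrightarrow> (v, w) \<in> S" if "v \<in> ?V" "w \<in> ?V" for v w
  proof
    assume "(\<phi> v, \<phi> w) \<in> R"
    then obtain v' w' where "(v', w') \<in> S" "\<phi> v = \<phi> v'" "\<phi> w = \<phi> w'" by (auto simp: R_def)
    then show "(v, w) \<in> S" using that S_V inj_onD[OF inj] by metis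
  qed (auto simp: R_def)
  let ?H = "\<lparr>pverts = marcs L, parcs = R\<rparr>"
  have R_sub: "R \<subseteq> marcs L \<times> marcs L" using S_V by (auto simp: R_def marcs)
  have sym_R: "sym R"
  proof (rule symI)
    fix x y assume "(x, y) \<in> R"
    then obtain v w where "(v, w) \<in> S" "x = \<phi> v" "y = \<phi> w" by (auto simp: R_def)
    then show "(y, x) \<in> R" using symD[OF sym_S] by (auto simp: R_def)
  qed
  interpret H: pair_wf_digraph ?H using R_sub by unfold_locales auto
  \<comment> \<open>Since \<open>\<phi>\<close> carries \<open>S\<close> to \<open>R\<close>, the
    components of \<open>R\<close> are the images of the blocks, and by \<open>out\<close> these are
    the sets of arcs with a common tail.\<close>
  have reach: "\<phi> v \<rightarrow>\<^sup>*\<^bsub>with_proj ?H\<^esub> x \<longleftrightarrow> x \<in> \<phi> ` B v" if v: "v \<in> ?V" for v x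
  proof
    assume "\<phi> v \<rightarrow>\<^sup>*\<^bsub>with_proj ?H\<^esub> x"
    then have "(\<phi> v, x) \<in> R\<^sup>*" using H.reachable_conv by simp
    then show "x \<in> \<phi> ` B v"
    proof (induction rule: rtrancl_induct)
      case (step y z)
      then obtain w where w: "y = \<phi> w" "w \<in> B v" by auto
      then have wV: "w \<in> ?V" using B_V v by blast
      from step(2) R_sub marcs obtain u where u: "z = \<phi> u" "u \<in> ?V" by auto
      with step(2) w wV R_iff have "(w, u) \<in> S" by simp
      with w have "u \<in> B v" by (auto simp: B_def)
      then show ?case using u by simp
    qed (use B_self in simp)
  next
    assume "x \<in> \<phi> ` B v"
    then obtain w where x: "x = \<phi> w" and w: "w \<in> B v" by blast
    from w have "(v, w) \<in> S\<^sup>*" by (simp add: B_def)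
    then have "(\<phi> v, \<phi> w) \<in> R\<^sup>*"
      by (induction rule: rtrancl_induct) (auto simp: R_def intro: rtrancl_into_rtrancl)
    then show "\<phi> v \<rightarrow>\<^sup>*\<^bsub>with_proj ?H\<^esub> x"
      unfolding x H.reachable_conv using v w B_V[OF v] marcs by auto
  qed
  have "pre_digraph.sccs_verts (with_proj ?H) = out L ` mverts L"
  proof -
    have "symmetric (with_proj ?H)" using sym_R by (simp add: symmetric_def)
    then have "H.sccs_verts = (\<lambda>x. {y. x \<rightarrow>\<^sup>*\<^bsub>with_proj ?H\<^esub> y}) ` marcs L"
      using H.sccs_verts_symmetric by simp
    also have "\<dots> = (\<lambda>v. {y. \<phi> v \<rightarrow>\<^sup>*\<^bsub>with_proj ?H\<^esub> y}) ` ?V"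
      using marcs by (metis (no_types, lifting) image_cong image_image)
    also have "\<dots> = (\<lambda>v. \<phi> ` B v) ` ?V"
      using reach by (intro image_cong) auto
    also have "\<dots> = out L ` mverts L"
      unfolding L_def multigraph.simps image_image using out by (intro image_cong) (simp_all flip: L_def)
    finally show ?thesis .
  qed
  moreover have "regular 2 ?H"
    unfolding regular_def out_degree_eq_card_nbhd
  proof
    fix x assume "x \<in> pverts ?H"
    then obtain v where v: "v \<in> ?V" "x = \<phi> v" by (auto simp: marcs)
    have "nbhd ?H x = \<phi> ` (N v - {m v})"
    proof (intro equalityI subsetI)
      fix y assume "y \<in> nbhd ?H x"
      then have "(\<phi> v, y) \<in> R" by (simp add: nbhd_def v)
      moreover from this obtain w where "y = \<phi> w" "w \<in> ?V" using R_sub marcs by auto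
      ultimately show "y \<in> \<phi> ` (N v - {m v})" using R_iff v by (auto simp: S_def)
    next
      fix y assume "y \<in> \<phi> ` (N v - {m v})"
      then show "y \<in> nbhd ?H x" using v by (auto simp: nbhd_def R_def S_def)
    qed
    moreover have "card (N v - {m v}) = 2" using card_N m_N v by simp
    moreover have "inj_on \<phi> (N v - {m v})"
      by (rule inj_on_subset[OF inj]) (use N_subset in blast)
    ultimately show "card (nbhd ?H x) = 2" by (simp add: card_image)
  qed
  moreover have "irrefl R"
    unfolding irrefl_def
  proof (intro allI notI)
    fix x assume x: "(x, x) \<in> R"
    then obtain v where "v \<in> ?V" "x = \<phi> v" using R_sub marcs by auto
    then show False using R_iff x N_irrefl by (auto simp: S_def)
  qed
  ultimately have scheme: "dihedral_scheme L R"
    using R_sub sym_R by (simp add: dihedral_scheme_def)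
  have "multigraph L"
    unfolding multigraph_def using card_ends by (auto simp: L_def)
  moreover have "loopless L" unfolding loopless_def using card_ends by simp
  moreover have "tetravalent L"
    unfolding tetravalent_def
  proof
    fix u assume "u \<in> mverts L"
    then obtain v where v: "v \<in> ?V" "u = t v" by (auto simp: L_def)
    have "card (\<phi> ` B v) = card (B v)" by (rule card_image[OF inj_on_subset[OF inj B_V[OF v(1)]]])
    then show "card (out L u) = 4" using out block v by simp
  qed
  moreover have "digraph_iso (with_proj G) (with_proj (truncation L R))"
  proof (rule digraph_isoI[OF pair_wf_digraph_axioms])
    show "bij_betw \<phi> (pverts G) (pverts (truncation L R))"
      using inj by (simp add: bij_betw_def truncation_def marcs)
    show "parcs (truncation L R) \<subseteq> pverts (truncation L R) \<times> pverts (truncation L R)"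
      by (auto simp: truncation_def)
    fix v w assume vw: "v \<in> pverts G" "w \<in> pverts G"
    have "(\<phi> v, \<phi> w) \<in> parcs (truncation L R) \<longleftrightarrow> (v, w) \<in> S \<or> v \<noteq> w \<and> e v = e w"
      using vw R_iff inj_on_eq_iff[OF inj vw]
      by (auto simp: truncation_def marcs mutually_inverse_def arc_edge_def) (auto simp: \<phi>_def)
    also have "\<dots> \<longleftrightarrow> w \<in> N v"
      using e_eq[OF vw] m_N[OF vw(1)] m_ne[OF vw(1)] by (auto simp: S_def)
    finally show "(\<phi> v, \<phi> w) \<in> parcs (truncation L R) \<longleftrightarrow> (v, w) \<in> parcs G"
      by (simp add: nbhd_def)
  qed
  ultimately show ?thesis using scheme by blast
qed

end

section \<open>Girth-regular graphs: twins and the case distinction\<close>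

locale girth_regular_cubic_girth_4 = cubic_girth_4 +
  assumes girth_regular: "girth_regular G"
begin

text \<open>Every two of \<open>a\<close>, \<open>b\<close>, \<open>c\<close> share both
  \<open>v\<close> and \<open>w\<close>, so the signature sum at \<open>v\<close> is at least 6. If
  \<open>x\<close> were adjacent to neither \<open>a\<close> nor \<open>b\<close>, then among the
  pairs of neighbours of \<open>c\<close> only \<open>v\<close> and \<open>w\<close> would have
  common neighbours besides \<open>c\<close>, namely two, and the sum at \<open>c\<close> would be
  4.\<close>

lemma twin_third_neighbour:
  assumes vw: "v \<noteq> w" and N: "N v = {a, b, c}" "N w = {a, b, c}"
    and abc: "a \<noteq> b" "a \<noteq> c" "b \<noteq> c"
    and x: "x \<in> N c" "x \<noteq> v" "x \<noteq> w"
  shows "x \<in> N a \<or> x \<in> N b"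
proof (rule ccontr)
  assume nx: "\<not> ?thesis"
  have vw_in: "{v, w} \<subseteq> N y" if "y \<in> {a, b, c}" for y
    using that N N_sym by blast
  have V: "c \<in> pverts G" "v \<in> pverts G" using N_vert[OF x(1)] N N_vert by blast+
  have "N c = {v, w, x}" using vw_in x vw V card_N by (intro card_3_eqI) auto
  moreover have "N v \<inter> N x = {c}" "N w \<inter> N x = {c}" using N x nx N_sym[of x] by auto
  ultimately have "sum_list (signature G c) = 4"
    using sum_list_signature_excess[of c v w x] vw x N abc by (simp add: excess_def)
  moreover have "1 \<le> excess y z" if "y \<in> {a, b, c}" "z \<in> {a, b, c}" for y z
  proof -
    have "card {v, w} \<le> card (N y \<inter> N z)" using vw_in that by (intro card_mono) auto
    then show ?thesis using vw by (simp add: excess_def)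
  qed
  then have "1 \<le> excess a b" "1 \<le> excess a c" "1 \<le> excess b c" by auto
  then have "6 \<le> sum_list (signature G v)"
    using sum_list_signature_excess[OF N(1) abc] by simp
  moreover have "signature G v = signature G c"
    using girth_regular V unfolding girth_regular_def by blast
  ultimately show False by simp
qed

lemma iso_K33:
  assumes vw: "v \<noteq> w" "v \<in> pverts G" "w \<in> pverts G" "N v = N w"
  shows "digraph_iso (with_proj G) (with_proj (moebius_ladder 3))"
proof -
  obtain a where "a \<in> N v" using card_N vw by (metis card.empty ex_in_conv zero_neq_numeral)
  then obtain b c where N: "N v = {a, b, c}" and abc: "a \<noteq> b" "a \<noteq> c" "b \<noteq> c"
    using card_3_obtain_others card_N vw by metis
  have Nw: "N w = {a, b, c}" using N vw by simp
  have third: "\<exists>x. N y = {v, w, x} \<and> x \<noteq> v \<and> x \<noteq> w" if "y \<in> {a, b, c}" for y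
  proof -
    have "v \<in> N y" "w \<in> N y" using that N Nw N_sym by blast+
    then show ?thesis using card_3_obtain_third[of "N y" v w] card_N N_vert vw by metis
  qed
  obtain x where x: "N a = {v, w, x}" "x \<noteq> v" "x \<noteq> w" using third by blast
  obtain y where y: "N b = {v, w, y}" "y \<noteq> v" "y \<noteq> w" using third by blast
  obtain z where z: "N c = {v, w, z}" "z \<noteq> v" "z \<noteq> w" using third by blast
  have perm: "{b, c, a} = {a, b, c}" "{a, c, b} = {a, b, c}" by auto
  \<comment> \<open>Each of the three third neighbours agrees with one of the other two, so all
    three coincide and the graph closes up.\<close>
  have "x = y \<or> x = z"
    using twin_third_neighbour[of v w b c a x] vw N abc x y z perm by auto
  moreover have "y = x \<or> y = z"
    using twin_third_neighbour[of v w a c b y] vw N abc x y z perm by auto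
  moreover have "z = x \<or> z = y"
    using twin_third_neighbour[of v w a b c z] vw N abc x y z perm by auto
  ultimately have xyz: "y = x" "z = x" by auto
  have ne: "v \<notin> {a, b, c}" "w \<notin> {a, b, c}" using N_irrefl N vw by metis+
  have "x \<notin> N v" using triangle_free[of a v x] N x by auto
  then have xne: "x \<notin> {a, b, c}" using N by simp
  have adj: "a \<in> N v" "b \<in> N v" "c \<in> N v" "a \<in> N w" "b \<in> N w" "c \<in> N w" "a \<in> N x" "b \<in> N x" "c \<in> N x"
    using N Nw x y z xyz N_sym by auto
  have less6: "i < 6 \<longleftrightarrow> i = 0 \<or> i = 1 \<or> i = 2 \<or> i = 3 \<or> i = 4 \<or> i = 5" for i :: nat by auto
  show ?thesis
  \<comment> \<open>A 6-cycle alternating between the two parts of the bipartition; positions that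
    differ by 3 are in different parts and hence adjacent.\<close>
  proof (rule iso_moebius_ladder[of 3 "(!) [v, a, w, b, x, c]"])
    show "inj_on ((!) [v, a, w, b, x, c]) {..<2 * 3}"
      using ne xne abc x vw by (intro inj_on_nth) auto
  qed (use x y z xyz adj in \<open>auto simp: less6\<close>)
qed

theorem classification:
  "(\<exists>n \<ge> 3. digraph_iso (with_proj G) (with_proj (moebius_ladder n)))
    \<or> (\<exists>n \<ge> 4. digraph_iso (with_proj G) (with_proj (prism n)))
    \<or> (\<exists>(L :: (nat, nat) multigraph) R. multigraph L \<and> loopless L \<and> tetravalent L \<and>
        dihedral_scheme L R \<and> digraph_iso (with_proj G) (with_proj (truncation L R)))"
proof (cases "\<exists>v \<in> pverts G. \<exists>w \<in> pverts G. v \<noteq> w \<and> N v = N w")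
  case True
  then show ?thesis using iso_K33 by blast
next
  case False
  then have twin_free: "v = w" if "v \<in> pverts G" "w \<in> pverts G" "N v = N w" for v w
    using that by blast
  define corner where "corner v a b \<longleftrightarrow> (\<exists>z. z \<noteq> v \<and> z \<in> N a \<and> z \<in> N b)" for v a b
  \<comment> \<open>Three common neighbours would be the full neighbourhoods and make
    \<open>a\<close> and \<open>b\<close> twins. So a 2-path lies on at most one 4-cycle, and
    \<open>corner v a b\<close> tells whether the one through \<open>v\<close> does.\<close>
  have excess_le: "excess a b \<le> 1" if ab: "a \<in> pverts G" "b \<in> pverts G" "a \<noteq> b" for a b
  proof -
    have "card (N a \<inter> N b) \<noteq> 3"
    proof
      assume *: "card (N a \<inter> N b) = 3"
      have "N a \<inter> N b = N a" "N a \<inter> N b = N b"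
        by (rule card_subset_eq; use * card_N ab in simp)+
      then show False using twin_free ab by metis
    qed
    moreover have "card (N a \<inter> N b) \<le> 3" using card_mono[of "N a" "N a \<inter> N b"] card_N ab by simp
    ultimately show ?thesis by (simp add: excess_def)
  qed
  have excess_eq: "excess a b = (if corner v a b then 1 else 0)"
    if ab: "a \<in> N v" "b \<in> N v" "a \<noteq> b" for v a b
  proof -
    have v: "v \<in> N a \<inter> N b" using ab N_sym by auto
    have "excess a b = card (N a \<inter> N b - {v})" using v by (simp add: excess_def)
    also have "\<dots> = 0 \<longleftrightarrow> \<not> corner v a b" by (auto simp: corner_def)
    finally have "excess a b = 0 \<longleftrightarrow> \<not> corner v a b" .
    moreover have "excess a b \<le> 1" using excess_le ab N_subset by blast
    ultimately show ?thesis by auto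
  qed
  have corner_commute: "corner v a b \<longleftrightarrow> corner v b a" for v a b by (auto simp: corner_def)
  \<comment> \<open>This \<open>k\<close> is the sum of the signature, hence twice the number of
    4-cycles through a vertex: the cases of one, two and three 4-cycles appear below as
    \<open>k = 2\<close>, \<open>k = 4\<close> and \<open>k = 6\<close>.\<close>
  obtain k where sig: "\<And>v. v \<in> pverts G \<Longrightarrow> sum_list (signature G v) = k"
    using girth_regular unfolding girth_regular_def by metis
  have local: "\<exists>a b c. N v = {a, b, c} \<and> a \<noteq> b \<and> a \<noteq> c \<and> b \<noteq> c \<and>
      k = 2 * ((if corner v a b then 1 else 0) + (if corner v a c then 1 else 0) +
        (if corner v b c then 1 else 0))" if v: "v \<in> pverts G" for v
  proof -
    obtain a b c where N: "N v = {a, b, c}" "a \<noteq> b" "a \<noteq> c" "b \<noteq> c"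
      using card_N[OF v] by (auto simp: card_3_iff)
    have "k = 2 * (excess a b + excess a c + excess b c)"
      using sum_list_signature_excess[OF N] sig[OF v] by simp
    moreover have "excess a b = (if corner v a b then 1 else 0)"
      "excess a c = (if corner v a c then 1 else 0)" "excess b c = (if corner v b c then 1 else 0)"
      by (rule excess_eq; use N in simp)+
    ultimately have "k = 2 * ((if corner v a b then 1 else 0) + (if corner v a c then 1 else 0) +
        (if corner v b c then 1 else 0))" by simp
    with N show ?thesis by (intro exI conjI)
  qed
  obtain p q s t where "square p q s t" using square_exists by blast
  then have "q \<in> N p" "t \<in> N p" "q \<noteq> t" "s \<noteq> p" "s \<in> N q" "s \<in> N t"
    using N_sym[of t p] N_sym[of s t] by (auto simp: square_def)
  then have sq: "p \<in> pverts G" "q \<in> N p" "t \<in> N p" "q \<noteq> t" "corner p q t"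
    using N_vert by (auto simp: corner_def)
  have "k \<noteq> 0"
  proof
    assume "k = 0"
    then obtain a b c where "N p = {a, b, c}" "\<not> corner p a b" "\<not> corner p a c" "\<not> corner p b c"
      using local[OF sq(1)] by (auto split: if_splits)
    then show False using sq corner_commute[of p] by auto
  qed
  then consider "k = 2" | "k = 4" | "k = 6"
    using local[OF sq(1)] by (auto split: if_splits)
  then show ?thesis
  proof cases
    case 1
    \<comment> \<open>One pair of neighbours lies on a 4-cycle; \<open>c\<close> is the neighbour
      left out.\<close>
    have "\<exists>c \<in> N v. \<forall>a \<in> N v. \<forall>b \<in> N v. a \<noteq> b \<longrightarrow> corner v a b \<longleftrightarrow> a \<noteq> c \<and> b \<noteq> c"
      if v: "v \<in> pverts G" for v
    proof -
      obtain a b c where N: "N v = {a, b, c}" "a \<noteq> b" "a \<noteq> c" "b \<noteq> c"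
        and "k = 2 * ((if corner v a b then 1 else 0) + (if corner v a c then 1 else 0) +
          (if corner v b c then 1 else 0))"
        using local[OF v] by blast
      then consider "corner v a b" "\<not> corner v a c" "\<not> corner v b c"
      | "\<not> corner v a b" "corner v a c" "\<not> corner v b c"
      | "\<not> corner v a b" "\<not> corner v a c" "corner v b c"
        using \<open>k = 2\<close> by (auto split: if_splits)
      then show ?thesis
      proof cases
        case 1
        then show ?thesis using N corner_commute[of v] by (intro bexI[of _ c]) auto
      next
        case 2
        then show ?thesis using N corner_commute[of v] by (intro bexI[of _ b]) auto
      next
        case 3
        then show ?thesis using N corner_commute[of v] by (intro bexI[of _ a]) auto
      qed
    qed
    then obtain m where "\<And>v. v \<in> pverts G \<Longrightarrow> m v \<in> N v \<and>
      (\<forall>a \<in> N v. \<forall>b \<in> N v. a \<noteq> b \<longrightarrow> corner v a b \<longleftrightarrow> a \<noteq> m v \<and> b \<noteq> m v)"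
      by metis
    then show ?thesis using iso_truncation[of m] N_vert unfolding corner_def by blast
  next
    case 2
    \<comment> \<open>Two pairs of neighbours lie on 4-cycles; \<open>c\<close> is their common
      member, so the edge to it is on both 4-cycles.\<close>
    have "\<exists>c \<in> N v. \<forall>a \<in> N v. \<forall>b \<in> N v. a \<noteq> b \<longrightarrow> corner v a b \<longleftrightarrow> a = c \<or> b = c"
      if v: "v \<in> pverts G" for v
    proof -
      obtain a b c where N: "N v = {a, b, c}" "a \<noteq> b" "a \<noteq> c" "b \<noteq> c"
        and "k = 2 * ((if corner v a b then 1 else 0) + (if corner v a c then 1 else 0) +
          (if corner v b c then 1 else 0))"
        using local[OF v] by blast
      then consider "\<not> corner v a b" "corner v a c" "corner v b c"
      | "corner v a b" "\<not> corner v a c" "corner v b c"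
      | "corner v a b" "corner v a c" "\<not> corner v b c"
        using \<open>k = 4\<close> by (auto split: if_splits)
      then show ?thesis
      proof cases
        case 1
        then show ?thesis using N corner_commute[of v] by (intro bexI[of _ c]) auto
      next
        case 2
        then show ?thesis using N corner_commute[of v] by (intro bexI[of _ b]) auto
      next
        case 3
        then show ?thesis using N corner_commute[of v] by (intro bexI[of _ a]) auto
      qed
    qed
    then obtain r where r_N: "\<And>v. v \<in> pverts G \<Longrightarrow> r v \<in> N v" and
      r: "\<And>v a b. v \<in> pverts G \<Longrightarrow> a \<in> N v \<Longrightarrow> b \<in> N v \<Longrightarrow> a \<noteq> b \<Longrightarrow> corner v a b \<longleftrightarrow> a = r v \<or> b = r v"
      by metis
    \<comment> \<open>The two 4-cycles at \<open>v\<close> pass through \<open>r v\<close> and leave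
      it towards \<open>y\<close> and \<open>z\<close>. The 2-paths from \<open>v\<close> through
      \<open>r v\<close> to \<open>y\<close> and to \<open>z\<close> both lie on 4-cycles, so both
      contain \<open>r (r v)\<close>; as \<open>y \<noteq> z\<close>, this can only be
      \<open>v\<close>.\<close>
    have r_r: "r (r v) = v" if v: "v \<in> pverts G" for v
    proof -
      let ?c = "r v"
      obtain a b where Nv: "N v = {?c, a, b}" and ne: "?c \<noteq> a" "?c \<noteq> b" "a \<noteq> b"
        using card_3_obtain_others[OF card_N[OF v] r_N[OF v]] .
      obtain y where y: "y \<noteq> v" "y \<in> N a" "y \<in> N ?c"
        using r[OF v, of a ?c] Nv ne by (auto simp: corner_def)
      obtain z where z: "z \<noteq> v" "z \<in> N b" "z \<in> N ?c"
        using r[OF v, of b ?c] Nv ne by (auto simp: corner_def)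
      have "y \<noteq> z" using r[OF v, of a b] Nv ne y z by (auto simp: corner_def)
      have c: "?c \<in> pverts G" using N_vert y by blast
      have vN: "v \<in> N ?c" "v \<in> N a" "v \<in> N b" using Nv N_sym by auto
      have "corner ?c v y"
        unfolding corner_def using Nv y ne N_sym[of a y] by (intro exI[of _ a]) auto
      then have "v = r ?c \<or> y = r ?c" using r[OF c] vN y by blast
      moreover have "corner ?c v z"
        unfolding corner_def using Nv z ne N_sym[of b z] by (intro exI[of _ b]) auto
      then have "v = r ?c \<or> z = r ?c" using r[OF c] vN z by blast
      ultimately show ?thesis using \<open>y \<noteq> z\<close> by auto
    qed
    \<comment> \<open>The edges from \<open>v\<close> to \<open>w\<close> and to \<open>r v\<close>
      span a 4-cycle with fourth vertex \<open>z\<close>. Its corner at \<open>w\<close> must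
      contain \<open>r w\<close>, which is not \<open>v\<close> because \<open>r\<close> is an
      involution and \<open>w \<noteq> r v\<close>; so \<open>r w = z\<close>.\<close>
    have "r w \<in> N (r v)" if w: "w \<in> N v" "w \<noteq> r v" for v w
    proof -
      have V: "v \<in> pverts G" "w \<in> pverts G" using w N_vert N_subset by blast+
      obtain z where z: "z \<noteq> v" "z \<in> N w" "z \<in> N (r v)"
        using r[OF V(1) w(1) r_N[OF V(1)] w(2)] by (auto simp: corner_def)
      have "v \<in> N w" using w N_sym by blast
      moreover have "corner w v z"
        unfolding corner_def using w z r_N[OF V(1)] N_sym[of "r v" z] by (intro exI[of _ "r v"]) auto
      ultimately have "v = r w \<or> z = r w" using r[OF V(2)] z by blast
      moreover have "v \<noteq> r w" using r_r[OF V(2)] w by auto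
      ultimately show ?thesis using z by auto
    qed
    then show ?thesis using moebius_ladder_or_prism[of r] r_N r_r by blast
  next
    case 3
    have "corner v a b" if "a \<in> N v" "b \<in> N v" "a \<noteq> b" for v a b
      using local[OF N_vert[OF that(1)]] 3 that corner_commute[of v] by (auto split: if_splits)
    then have "digraph_iso (with_proj G) (with_proj (prism 4))"
      using twin_free unfolding corner_def by (intro iso_cube) auto
    then show ?thesis by blast
  qed
qed

end

theorem theorem4p2:
  fixes \<Gamma> :: "'a pair_pre_digraph"
  assumes "pair_graph \<Gamma>"
    and "Digraph_Component.connected \<Gamma>"
    and "regular 3 \<Gamma>"
    and "girth_regular \<Gamma>"
    and "girth \<Gamma> = 4"
  shows "(\<exists>n \<ge> 3. digraph_iso \<Gamma> (moebius_ladder n))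
    \<or> (\<exists>n \<ge> 4. digraph_iso \<Gamma> (prism n))
    \<or> (\<exists>(\<Lambda> :: (nat, nat) multigraph) R.
          multigraph \<Lambda> \<and> loopless \<Lambda> \<and> tetravalent \<Lambda> \<and> dihedral_scheme \<Lambda> R
          \<and> digraph_iso \<Gamma> (truncation \<Lambda> R))"
proof -
  interpret girth_regular_cubic_girth_4 \<Gamma>
    using assms
    by (simp add: girth_regular_cubic_girth_4_def girth_regular_cubic_girth_4_axioms_def
        cubic_girth_4_def cubic_girth_4_axioms_def connected_cubic_graph_def
        connected_cubic_graph_axioms_def)
  show ?thesis by (rule classification)
qed

end
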